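(* For each integer $n\ge 4$, let $f(n)$ be the minimum, over all badly ordered pairs $\frac ab<\frac cd$ in the Farey sequence $\mathcal F_n$, of the number of fractions of $\mathcal F_n$ lying strictly between $\frac ab$ and $\frac cd$. Then, as $n\to\infty$, $$f(n)=\left(\frac14+o(1)\right)n.$$ Consequently, Erdős Problem 1005 has asymptotic constant $c=1/4$: if $g(n)$ denotes the largest integer such that any two fractions of $\mathcal F_n$ whose positions in the increasing ordering of $\mathcal F_n$ differ by at most $g(n)$ are similarly ordered, then $g(n)=\left(\frac14+o(1)\right)n$ as $n\to\infty$.
   Context: The Farey sequence $\mathcal F_n$ of order $n$ is the increasing sequence of all reduced fractions $a/b\in[0,1]$ with $1\le b\le n$ (so $0=0/1$ and $1=1/1$ belong to it). All fractions are written in lowest terms with positive denominator. Two fractions $\frac ab<\frac cd$ of $\mathcal F_n$ are badly ordered if $a<c$ and $b>d$. Two fractions $\frac ab,\frac cd$ of $\mathcal F_n$ are similarly ordered if $(a-c)(b-d)\ge 0$; for $\frac ab<\frac cd$ this is equivalent to the pair not being badly ordered. Badly ordered pairs exist in $\mathcal F_n$ exactly when $n\ge 4$. *)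

theory Defs
  imports Complex_Main "HOL-Library.Landau_Symbols"
begin

abbreviation numer :: "rat \<Rightarrow> int" where
  "numer q \<equiv> fst (quotient_of q)"

abbreviation denom :: "rat \<Rightarrow> int" where
  "denom q \<equiv> snd (quotient_of q)"

definition farey :: "nat \<Rightarrow> rat set" where
  "farey n = {q. 0 \<le> q \<and> q \<le> 1 \<and> denom q \<le> int n}"

definition farey_seq :: "nat \<Rightarrow> rat list" where
  "farey_seq n = sorted_list_of_set (farey n)"

definition badly_ordered :: "rat \<Rightarrow> rat \<Rightarrow> bool" where
  "badly_ordered x y \<longleftrightarrow> x < y \<and> numer x < numer y \<and> denom x > denom y"

definition similarly_ordered :: "rat \<Rightarrow> rat \<Rightarrow> bool" where
  "similarly_ordered x y \<longleftrightarrow> (numer x - numer y) * (denom x - denom y) \<ge> 0"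

(* Only meaningful for n \<ge> 4: below that, Min is applied to the empty set. *)
definition min_between :: "nat \<Rightarrow> nat" where
  "min_between n =
     Min {card {z \<in> farey n. x < z \<and> z < y} | x y.
            x \<in> farey n \<and> y \<in> farey n \<and> badly_ordered x y}"

definition similar_within :: "nat \<Rightarrow> int \<Rightarrow> bool" where
  "similar_within n k \<longleftrightarrow>
     (\<forall>i < length (farey_seq n). \<forall>j < length (farey_seq n).
        \<bar>int i - int j\<bar> \<le> k \<longrightarrow>
        similarly_ordered (farey_seq n ! i) (farey_seq n ! j))"

(* Only meaningful for n \<ge> 4: below that, every k satisfies similar_within n k. *)
definition similar_range :: "nat \<Rightarrow> int" where
  "similar_range n = (GREATEST k. similar_within n k)"

text \<open>
  For \<open>n \<ge> 4\<close> the minimum and the maximum above exist, so \<^const>\<open>min_between\<close> and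
  \<^const>\<open>similar_range\<close> have their intended values.
\<close>

lemma finite_farey: "finite (farey n)"
proof (rule finite_subset)
  show "farey n \<subseteq> (\<lambda>(a, b). of_int a / of_int b) ` ({0..int n} \<times> {0..int n})"
  proof
    fix q assume q: "q \<in> farey n"
    obtain a b where ab: "quotient_of q = (a, b)" by force
    have b: "b > 0" and eq: "q = of_int a / of_int b"
      using quotient_of_denom_pos[OF ab] quotient_of_div[OF ab] by auto
    have bn: "b \<le> int n" and "0 \<le> q" "q \<le> 1" using q ab by (auto simp: farey_def)
    then have "0 \<le> a" "a \<le> b" using b unfolding eq by (auto simp: field_simps)
    then show "q \<in> (\<lambda>(a, b). of_int a / of_int b) ` ({0..int n} \<times> {0..int n})"
      using b bn eq by (intro image_eqI[of _ _ "(a, b)"]) auto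
  qed
qed auto

lemma ex_badly_ordered:
  assumes "n \<ge> 4"
  shows "\<exists>x\<in>farey n. \<exists>y\<in>farey n. badly_ordered x y"
proof -
  have "quotient_of (1/4) = (1, 4)" "quotient_of (2/3) = (2, 3)" by code_simp+
  then show ?thesis using assms
    by (intro bexI[of _ "1/4"] bexI[of _ "2/3"]) (auto simp: badly_ordered_def farey_def)
qed

lemma min_between_attained:
  assumes "n \<ge> 4"
  shows "\<exists>x\<in>farey n. \<exists>y\<in>farey n. badly_ordered x y \<and>
           min_between n = card {z \<in> farey n. x < z \<and> z < y}"
    and "\<lbrakk>x \<in> farey n; y \<in> farey n; badly_ordered x y\<rbrakk> \<Longrightarrow>
           min_between n \<le> card {z \<in> farey n. x < z \<and> z < y}"
proof -
  let ?S = "{card {z \<in> farey n. x < z \<and> z < y} | x y.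
            x \<in> farey n \<and> y \<in> farey n \<and> badly_ordered x y}"
  have "?S \<subseteq> (\<lambda>(x, y). card {z \<in> farey n. x < z \<and> z < y}) ` (farey n \<times> farey n)"
    by auto
  then have fin: "finite ?S"
    by (rule finite_subset) (simp add: finite_farey)
  have "?S \<noteq> {}" using ex_badly_ordered[OF assms] by auto
  then have "Min ?S \<in> ?S" by (rule Min_in[OF fin])
  then show "\<exists>x\<in>farey n. \<exists>y\<in>farey n. badly_ordered x y \<and>
           min_between n = card {z \<in> farey n. x < z \<and> z < y}"
    unfolding min_between_def[symmetric] by auto
  show "min_between n \<le> card {z \<in> farey n. x < z \<and> z < y}"
    if "x \<in> farey n" "y \<in> farey n" "badly_ordered x y"
    unfolding min_between_def by (rule Min_le[OF fin]) (use that in auto)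
qed

lemma similar_range_greatest:
  assumes "n \<ge> 4"
  shows "similar_within n (similar_range n)"
    and "similar_within n k \<Longrightarrow> k \<le> similar_range n"
proof -
  obtain x y where xy: "x \<in> farey n" "y \<in> farey n" "badly_ordered x y"
    using ex_badly_ordered[OF assms] by auto
  have "set (farey_seq n) = farey n" by (simp add: farey_seq_def finite_farey)
  then obtain i j where ij: "i < length (farey_seq n)" "j < length (farey_seq n)"
      "farey_seq n ! i = x" "farey_seq n ! j = y"
    using xy by (metis in_set_conv_nth)
  have bad: "\<not> similarly_ordered x y"
    using xy(3) by (auto simp: badly_ordered_def similarly_ordered_def not_le
        intro: mult_neg_pos)
  have bound: "k < \<bar>int i - int j\<bar>" if "similar_within n k" for k
    using that ij bad unfolding similar_within_def by (meson not_le)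
  define B where "B = nat \<bar>int i - int j\<bar>"
  define P where "P = (\<lambda>m. similar_within n (int m))"
  have P0: "P 0"
    by (auto simp: P_def similar_within_def similarly_ordered_def)
  have PB: "\<forall>m. P m \<longrightarrow> m \<le> B"
    using bound by (fastforce simp: P_def B_def)
  define G where "G = (GREATEST m. P m)"
  have PG: "P G" unfolding G_def using GreatestI_nat[of P 0 B] P0 PB by blast
  have "k \<le> int G" if "similar_within n k" for k
  proof (cases "k \<ge> 0")
    case True
    then have "P (nat k)" using that by (simp add: P_def)
    then have "nat k \<le> G" unfolding G_def using Greatest_le_nat[of P "nat k" B] PB by blast
    then show ?thesis by simp
  qed simp
  moreover from PG have "similar_within n (int G)" by (simp add: P_def)
  ultimately have "similar_range n = int G"
    unfolding similar_range_def by (intro Greatest_equality) auto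
  then show "similar_within n (similar_range n)"
    and "similar_within n k \<Longrightarrow> k \<le> similar_range n"
    using PG \<open>\<And>k. similar_within n k \<Longrightarrow> k \<le> int G\<close> by (auto simp: P_def)
qed

end

theory Submission
  imports Defs "HOL-Number_Theory.Totient" "HOL-Analysis.Kronecker_Approximation_Theorem"
    "HOL-Real_Asymp.Real_Asymp"
begin

text \<open>
  A badly ordered pair \<open>a/b < c/d\<close> satisfies \<open>c/d \<ge> (a + 1)/(b - 1)\<close>, so it encloses the interval
  \<open>[x, x']\<close> with \<open>x = a/b\<close> and \<open>x' = x + (1 + x)/(n - 1)\<close>. Choose \<open>p/q\<close> with \<open>q \<le> \<surd>n\<close> and
  \<open>\<bar>q x - p\<bar> < 1/\<surd>n\<close> up to rounding, and sort the primitive points \<open>(X, Y)\<close>, \<open>Y \<le> n\<close>, by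
  \<open>j = q X - p Y\<close>. Writing \<open>\<tau> = n (q x - p)\<close>, the interval becomes \<open>\<tau> \<le> n j/Y \<le> \<tau> + p + q\<close> (nearly), and
  sieving each line \<open>j = const\<close> shows that \<open>0 < n j/Y < v\<close> contains \<open>(n/q) G(v) + O(v powr (3/2))\<close>
  primitive points, where \<open>G(v) = (\<Sum>j\<le>v. \<phi>(j) (1/j - 1/v))\<close>. Only \<open>\<surd>n\<close> many lines are involved, so
  the error is \<open>O(n powr (3/4))\<close>. The bound \<open>n/4\<close> then reduces to \<open>G\<close> growing by at least \<open>1/4\<close> over every
  unit interval in \<open>[1, \<infinity>)\<close>, which follows from \<open>\<phi>(1) + \<dots> + \<phi>(m) \<ge> (m (m + 1) + 2)/4\<close>; the interval has
  length \<open>p + q \<ge> q + 1\<close>, which pays for the unit interval lost when it straddles \<open>0\<close>.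
  Equality is attained near \<open>1/2\<close>, by \<open>2k/(4k + 1) < (2k + 1)/(4k)\<close>.
\<close>

subsection \<open>Lower bound for the totient summatory function\<close>

definition totient_sum :: "nat \<Rightarrow> nat" where
  "totient_sum m = (\<Sum>j = 1..m. totient j)"

lemma totient_sum_0 [simp]: "totient_sum 0 = 0"
  by (simp add: totient_sum_def)

lemma totient_sum_Suc [simp]: "totient_sum (Suc m) = totient_sum m + totient (Suc m)"
  by (simp add: totient_sum_def)

lemma card_coprime_below:
  "card {k. 0 < k \<and> k < Suc (Suc m) \<and> coprime k (Suc (Suc m))} = totient (Suc (Suc m))"
proof -
  have "k \<noteq> Suc (Suc m)" if "coprime k (Suc (Suc m))" for k
    using that by auto
  then have "{k. 0 < k \<and> k < Suc (Suc m) \<and> coprime k (Suc (Suc m))} = totatives (Suc (Suc m))"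
    by (auto simp: totatives_def order_le_less)
  then show ?thesis by (simp add: totient_def)
qed

text \<open>Enlarging the square from side \<open>M - 1\<close> to \<open>M\<close> adds a row and a
  column with \<open>totient M\<close> coprime pairs each; the corner \<open>(M, M)\<close> is not
  coprime. The extra 1 makes up for \<open>(1, 1)\<close>, which is its own mirror image.\<close>

lemma card_coprime_square:
  "card {(i, k). i \<in> {1..Suc m} \<and> k \<in> {1..Suc m} \<and> coprime i k} + 1 = 2 * totient_sum (Suc m)"
proof (induction m)
  case 0
  have "{(i, k). i \<in> {1..Suc 0} \<and> k \<in> {1..Suc 0} \<and> coprime i k} = {(1, 1)}"
    by auto
  then show ?case by simp
next
  case (Suc m)
  define M where "M = Suc (Suc m)"
  define T where "T = {k. 0 < k \<and> k < M \<and> coprime k M}"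
  define S where "S = {(i, k). i \<in> {1..Suc m} \<and> k \<in> {1..Suc m} \<and> coprime i k}"
  have "{(i, k). i \<in> {1..M} \<and> k \<in> {1..M} \<and> coprime i k} = S \<union> (T \<times> {M} \<union> {M} \<times> T)"
    by (auto simp: S_def T_def M_def le_Suc_eq coprime_commute)
  moreover have "card (S \<union> (T \<times> {M} \<union> {M} \<times> T)) = card S + card (T \<times> {M} \<union> {M} \<times> T)"
  proof (rule card_Un_disjoint)
    show "finite S" by (rule finite_subset[of _ "{1..Suc m} \<times> {1..Suc m}"]) (auto simp: S_def)
  qed (auto simp: S_def T_def M_def)
  moreover have "card (T \<times> {M} \<union> {M} \<times> T) = card T + card T"
    by (subst card_Un_disjoint) (auto simp: T_def card_cartesian_product)
  moreover have "card T = totient M"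
    unfolding T_def M_def by (rule card_coprime_below)
  ultimately show ?case using Suc by (simp add: S_def M_def)
qed

text \<open>Telescoping: \<open>(2 k + 1)^2 \<ge> 4 k (k + 1)\<close>, and
  \<open>1 / (4 k (k + 1))\<close> is the difference of consecutive values of
  \<open>1 / (4 k)\<close>, which is 1/20 at \<open>k = 5\<close>.\<close>

lemma sum_inverse_odd_squares_le:
  "(\<Sum>k = 5..<N. 1 / (2 * real k + 1)\<^sup>2) \<le> 1/20"
proof -
  have "(\<Sum>k = 5..<N. 1 / (2 * real k + 1)\<^sup>2) \<le> 1/20 - 1 / (4 * real N)" if "N \<ge> 5"
    using that
  proof (induction N rule: dec_induct)
    case base
    then show ?case by simp
  next
    case (step N)
    have "1 / (2 * real N + 1)\<^sup>2 \<le> 1 / (4 * (real N * (real N + 1)))"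
      using step by (intro frac_le mult_pos_pos) (auto simp: power2_eq_square algebra_simps)
    also have "\<dots> = 1 / (4 * real N) - 1 / (4 * real (Suc N))"
      using step by (simp add: divide_simps)
    finally have "1 / (2 * real N + 1)\<^sup>2 \<le> 1 / (4 * real N) - 1 / (4 * real (Suc N))" .
    with step show ?case by simp
  qed
  moreover have "1/20 - 1 / (4 * real N) \<le> 1/20" by simp
  ultimately show ?thesis
    by (cases "N \<ge> 5") (blast intro: order_trans, simp)
qed

text \<open>The primes 2, 3, 5, 7 contribute about 0.4215; every further prime is
  \<open>2 k + 1\<close> with \<open>k \<ge> 5\<close>, and these add at most 1/20. What matters
  later is that the total stays below 1/2.\<close>

lemma sum_inverse_prime_squares_le:
  "(\<Sum>p | prime p \<and> p \<le> m. 1 / real p ^ 2) \<le> 59/125" for m :: nat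
proof -
  have cases: "p \<in> {2, 3, 5, 7} \<union> (\<lambda>k. 2 * k + 1) ` {5..<Suc m}" if "prime p" "p \<le> m" for p :: nat
  proof (cases "p \<ge> 11")
    case True
    then have "odd p" using that prime_odd_nat by auto
    then obtain k where "p = 2 * k + 1" by (elim oddE)
    then show ?thesis using True that by auto
  next
    case False
    have "\<not> prime (4::nat)" "\<not> prime (6::nat)" "\<not> prime (8::nat)" "\<not> prime (9::nat)" "\<not> prime (10::nat)"
      by simp_all
    moreover have "p = 0 \<or> p = 1 \<or> p = 2 \<or> p = 3 \<or> p = 4 \<or> p = 5 \<or> p = 6 \<or> p = 7 \<or>
        p = 8 \<or> p = 9 \<or> p = 10" using False by arith
    ultimately show ?thesis using that by auto
  qed
  have "(\<Sum>p | prime p \<and> p \<le> m. 1 / real p ^ 2) \<le>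
      (\<Sum>p\<in>{2, 3, 5, 7} \<union> (\<lambda>k. 2 * k + 1) ` {5..<Suc m}. 1 / real p ^ 2)"
    by (rule sum_mono2) (use cases in auto)
  also have "\<dots> = (\<Sum>p\<in>{2, 3, 5, 7::nat}. 1 / real p ^ 2) +
      (\<Sum>p\<in>(\<lambda>k. 2 * k + 1) ` {5..<Suc m}. 1 / real p ^ 2)"
    by (rule sum.union_disjoint) auto
  also have "(\<Sum>p\<in>(\<lambda>k. 2 * k + 1) ` {5..<Suc m}. 1 / real p ^ 2) =
      (\<Sum>k = 5..<Suc m. 1 / (2 * real k + 1)\<^sup>2)"
    by (subst sum.reindex) (auto simp: inj_on_def add.commute)
  also have "\<dots> \<le> 1/20" by (rule sum_inverse_odd_squares_le)
  finally show ?thesis by (simp add: power2_eq_square)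
qed

lemma card_multiples_le: "card {i \<in> {1..m}. p dvd i} \<le> m div p" if "p > 0" for p m :: nat
proof -
  have "{i \<in> {1..m}. p dvd i} \<subseteq> (\<lambda>k. p * k) ` {1..m div p}"
    using that by (auto elim!: dvdE simp: less_eq_div_iff_mult_less_eq mult.commute Suc_le_eq)
  then have "card {i \<in> {1..m}. p dvd i} \<le> card ((\<lambda>k. p * k) ` {1..m div p})"
    by (intro card_mono) auto
  also have "\<dots> \<le> m div p" using card_image_le[of "{1..m div p}"] by simp
  finally show ?thesis .
qed

text \<open>Union bound: a non-coprime pair in the square shares a prime \<open>p \<le> m\<close>,
  and at most \<open>(m / p)^2\<close> pairs are divisible by \<open>p\<close>. This leaves 66/125
  of the square, more than half.\<close>

lemma totient_sum_ge_aux: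
  assumes "m > 0"
  shows "2 * real (totient_sum m) \<ge> 66/125 * real m ^ 2 + 1"
proof -
  obtain m' where m': "m = Suc m'" using assms gr0_implies_Suc by blast
  define P where "P = {p::nat. prime p \<and> p \<le> m}"
  define A where "A = (\<lambda>p. {i \<in> {1..m}. p dvd i})"
  define C where "C = {(i, k). i \<in> {1..m} \<and> k \<in> {1..m} \<and> coprime i k}"
  have finP: "finite P" unfolding P_def by simp
  have "{1..m} \<times> {1..m} \<subseteq> C \<union> (\<Union>p\<in>P. A p \<times> A p)"
  proof safe
    fix i k assume ik: "i \<in> {1..m}" "k \<in> {1..m}" "(i, k) \<notin> (\<Union>p\<in>P. A p \<times> A p)"
    show "(i, k) \<in> C"
    proof (rule ccontr)
      assume "(i, k) \<notin> C"
      then have "gcd i k \<noteq> 1" using ik by (auto simp: C_def coprime_iff_gcd_eq_1)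
      then obtain p where p: "prime p" "p dvd gcd i k" using prime_factor_nat by blast
      then have "p dvd i" "p dvd k" by auto
      then have "p \<in> P" "i \<in> A p" "k \<in> A p" using p ik
        by (auto simp: P_def A_def dest!: dvd_imp_le)
      then show False using ik by blast
    qed
  qed
  then have "card ({1..m} \<times> {1..m}) \<le> card (C \<union> (\<Union>p\<in>P. A p \<times> A p))"
    by (rule card_mono[rotated])
      (auto simp: finP A_def C_def intro: finite_subset[of _ "{1..m} \<times> {1..m}"])
  also have "\<dots> \<le> card C + card (\<Union>p\<in>P. A p \<times> A p)" by (rule card_Un_le)
  also have "card (\<Union>p\<in>P. A p \<times> A p) \<le> (\<Sum>p\<in>P. card (A p \<times> A p))"
    by (rule card_UN_le[OF finP])
  finally have "real (m * m) \<le> real (card C) + (\<Sum>p\<in>P. real (card (A p)) * real (card (A p)))"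
    by (simp add: card_cartesian_product flip: of_nat_mult of_nat_sum of_nat_add)
  moreover have "(\<Sum>p\<in>P. real (card (A p)) * real (card (A p))) \<le> (\<Sum>p\<in>P. real m ^ 2 * (1 / real p ^ 2))"
  proof (rule sum_mono)
    fix p assume "p \<in> P"
    then have p: "p > 0" by (auto simp: P_def prime_gt_0_nat)
    have "real (card (A p)) \<le> real (m div p)"
      unfolding A_def using card_multiples_le[OF p, of m] by (simp only: of_nat_le_iff)
    also have "\<dots> \<le> real m / real p" by (rule of_nat_div_le_of_nat)
    finally have "real (card (A p)) * real (card (A p)) \<le> (real m / real p) * (real m / real p)"
      by (intro mult_mono) auto
    then show "real (card (A p)) * real (card (A p)) \<le> real m ^ 2 * (1 / real p ^ 2)"
      by (simp add: power2_eq_square)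
  qed
  moreover have "(\<Sum>p\<in>P. real m ^ 2 * (1 / real p ^ 2)) \<le> real m ^ 2 * (59/125)"
    unfolding P_def sum_distrib_left[symmetric]
    by (rule mult_left_mono[OF sum_inverse_prime_squares_le]) simp
  moreover have "real (card C) + 1 = 2 * real (totient_sum m)"
    using card_coprime_square[of m'] unfolding C_def m' by linarith
  ultimately show ?thesis by (simp add: power2_eq_square)
qed

text \<open>\<open>totient_sum_ge_aux\<close> beats the quadratic once \<open>7 m \<ge> 125\<close>,
  so from \<open>m = 18\<close> on; the smaller cases are a table of totients. Equality holds at
  \<open>m = 1\<close> and \<open>m = 2\<close>.\<close>

lemma totient_sum_ge:
  assumes "m > 0"
  shows "real (totient_sum m) \<ge> (real m * (real m + 1) + 2) / 4"
proof (cases "m \<ge> 18")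
  case True
  define X where "X = real m * real m"
  have "X \<ge> 18 * real m" using True unfolding X_def by (intro mult_right_mono) auto
  moreover have "66/125 * X + 1 \<le> 2 * real (totient_sum m)"
    using totient_sum_ge_aux[OF assms] by (simp add: X_def power2_eq_square)
  ultimately have "X + real m + 2 \<le> 4 * real (totient_sum m)"
    using True of_nat_0_le_iff[of m, where ?'a = real] by linarith
  then show ?thesis by (simp add: X_def algebra_simps)
next
  case False
  have pp: "totient (p ^ Suc k) = p ^ k * (p - 1)" if "prime p" for p k :: nat
    using totient_prime_power_Suc[OF that] by simp
  have primes: "totient 2 = 1" "totient 3 = 2" "totient 5 = 4" "totient 7 = 6" "totient 11 = 10"
    "totient 13 = 12" "totient 17 = 16"
    using totient_prime[of 2] totient_prime[of 3] totient_prime[of 5] totient_prime[of 7]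
      totient_prime[of 11] totient_prime[of 13] totient_prime[of 17] by simp_all
  have powers: "totient 4 = 2" "totient 8 = 4" "totient 16 = 8" "totient 9 = 6"
    using pp[of 2 1] pp[of 2 2] pp[of 2 3] pp[of 3 1] by simp_all
  have "coprime 2 (3::nat)" "coprime 2 (5::nat)" "coprime 4 (3::nat)" "coprime 2 (7::nat)" "coprime 3 (5::nat)"
    by (simp_all add: coprime_iff_gcd_eq_1 gcd_non_0_nat)
  note this[THEN totient_mult_coprime]
  with primes powers have products: "totient 6 = 2" "totient 10 = 4" "totient 12 = 4" "totient 14 = 6" "totient 15 = 8"
    by simp_all
  have step: "totient_sum (k + 1) = totient_sum k + totient (k + 1)" for k
    by simp
  have S1: "totient_sum 1 = 1" by (simp add: totient_sum_def)
  have S2: "totient_sum 2 = 2" using step[of 1] S1 by (simp only: one_add_one primes)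
  have S3: "totient_sum 3 = 4" using step[of 2] S2 primes powers products by simp
  have S4: "totient_sum 4 = 6" using step[of 3] S3 primes powers products by simp
  have S5: "totient_sum 5 = 10" using step[of 4] S4 primes powers products by simp
  have S6: "totient_sum 6 = 12" using step[of 5] S5 primes powers products by simp
  have S7: "totient_sum 7 = 18" using step[of 6] S6 primes powers products by simp
  have S8: "totient_sum 8 = 22" using step[of 7] S7 primes powers products by simp
  have S9: "totient_sum 9 = 28" using step[of 8] S8 primes powers products by simp
  have S10: "totient_sum 10 = 32" using step[of 9] S9 primes powers products by simp
  have S11: "totient_sum 11 = 42" using step[of 10] S10 primes powers products by simp
  have S12: "totient_sum 12 = 46" using step[of 11] S11 primes powers products by simp
  have S13: "totient_sum 13 = 58" using step[of 12] S12 primes powers products by simp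
  have S14: "totient_sum 14 = 64" using step[of 13] S13 primes powers products by simp
  have S15: "totient_sum 15 = 72" using step[of 14] S14 primes powers products by simp
  have S16: "totient_sum 16 = 80" using step[of 15] S15 primes powers products by simp
  have S17: "totient_sum 17 = 96" using step[of 16] S16 primes powers products by simp
  have "m = 1 \<or> m = 2 \<or> m = 3 \<or> m = 4 \<or> m = 5 \<or> m = 6 \<or> m = 7 \<or> m = 8 \<or> m = 9 \<or>
      m = 10 \<or> m = 11 \<or> m = 12 \<or> m = 13 \<or> m = 14 \<or> m = 15 \<or> m = 16 \<or> m = 17"
    using False assms by arith
  then have "m * (m + 1) + 2 \<le> 4 * totient_sum m"
    by (elim disjE) (simp_all add: S2 S3 S4 S5 S6 S7 S8 S9 S10 S11 S12 S13 S14 S15 S16 S17)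
  then have "real (m * (m + 1) + 2) \<le> real (4 * totient_sum m)" by (simp only: of_nat_le_iff)
  then show ?thesis by (simp add: field_simps)
qed

subsection \<open>The weight function\<close>

text \<open>Up to the factor \<open>n / q\<close>, the expected number of primitive points: line
  \<open>j\<close> has density \<open>totient j / j\<close> over a \<open>Y\<close>-range of length
  \<open>n (1 - j / v)\<close>. The derivative in \<open>v\<close>, away from integers, is the
  totient sum up to \<open>v\<close> divided by \<open>v^2\<close>.\<close>

definition totient_weight :: "real \<Rightarrow> real" where
  "totient_weight v = (\<Sum>j = 1..nat \<lfloor>v\<rfloor>. real (totient j) * (1 / real j - 1 / v))"

text \<open>Both ends of \<open>[m, m + 1]\<close> are allowed because the summand
  \<open>j = m + 1\<close> vanishes at \<open>v = m + 1\<close>.\<close>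

lemma totient_weight_eq:
  assumes "real m \<le> v" "v \<le> real m + 1" "m > 0"
  shows "totient_weight v = (\<Sum>j = 1..m. real (totient j) / real j) - real (totient_sum m) / v"
proof -
  have split: "(\<Sum>j = 1..m. real (totient j) * (1 / real j - 1 / v)) =
      (\<Sum>j = 1..m. real (totient j) / real j) - real (totient_sum m) / v"
    by (simp add: totient_sum_def right_diff_distrib sum_subtractf sum_divide_distrib)
  show ?thesis
  proof (cases "v = real m + 1")
    case True
    then have "nat \<lfloor>v\<rfloor> = Suc m" by linarith
    then show ?thesis using True split by (simp add: totient_weight_def add.commute)
  next
    case False
    then have "nat \<lfloor>v\<rfloor> = m" using assms by linarith
    then show ?thesis using split by (simp add: totient_weight_def)
  qed
qed

lemma totient_weight_nonneg: "totient_weight v \<ge> 0"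
  unfolding totient_weight_def
proof (rule sum_nonneg)
  fix j assume "j \<in> {1..nat \<lfloor>v\<rfloor>}"
  then have "real j \<ge> 1" "real j \<le> v" by (auto, linarith)
  then show "real (totient j) * (1 / real j - 1 / v) \<ge> 0"
    by (intro mult_nonneg_nonneg) (auto simp: field_simps)
qed

lemma totient_weight_eq_0: "v < 1 \<Longrightarrow> totient_weight v = 0"
  by (simp add: totient_weight_def)

lemma totient_weight_mono:
  assumes "u \<le> v"
  shows "totient_weight u \<le> totient_weight v"
proof -
  have "totient_weight u \<le> (\<Sum>j = 1..nat \<lfloor>u\<rfloor>. real (totient j) * (1 / real j - 1 / v))"
    unfolding totient_weight_def
  proof (rule sum_mono)
    fix j assume "j \<in> {1..nat \<lfloor>u\<rfloor>}"
    then have "real j \<ge> 1" "real j \<le> u" by (auto, linarith)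
    then show "real (totient j) * (1 / real j - 1 / u) \<le> real (totient j) * (1 / real j - 1 / v)"
      using assms by (intro mult_left_mono) (auto simp: frac_le)
  qed
  also have "\<dots> \<le> totient_weight v"
    unfolding totient_weight_def
  proof (rule sum_mono2)
    show "{1..nat \<lfloor>u\<rfloor>} \<subseteq> {1..nat \<lfloor>v\<rfloor>}" 
      using nat_mono[OF floor_mono[OF assms]] by auto
    fix j assume "j \<in> {1..nat \<lfloor>v\<rfloor>} - {1..nat \<lfloor>u\<rfloor>}"
    then have "real j \<ge> 1" "real j \<le> v" by (auto, linarith)
    then show "real (totient j) * (1 / real j - 1 / v) \<ge> 0"
      by (intro mult_nonneg_nonneg) (auto simp: field_simps)
  qed simp
  finally show ?thesis .
qed

text \<open>For \<open>u\<close> in \<open>[m, m + 1]\<close> the increment is a combination of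
  \<open>totient_sum m\<close> and \<open>totient_sum (m + 1)\<close> with nonnegative coefficients,
  so the quadratic lower bounds may be inserted.\<close>

lemma totient_weight_add_1:
  assumes "u \<ge> 1"
  shows "totient_weight (u + 1) \<ge> totient_weight u + 1/4"
proof -
  define m where "m = nat \<lfloor>u\<rfloor>"
  define M where "M = real m"
  define \<theta> where "\<theta> = u - M"
  have m: "m > 0" "M \<le> u" "u \<le> M + 1" using assms by (auto simp: m_def M_def)
  then have M: "M \<ge> 1" by (simp add: M_def)
  have \<theta>: "0 \<le> \<theta>" "\<theta> \<le> 1" and u: "u = M + \<theta>" using m by (auto simp: \<theta>_def)
  have "totient_weight (u + 1) - totient_weight u =
      real (totient_sum m) * (1 / u - 1 / (M + 1)) + real (totient_sum (Suc m)) * (1 / (M + 1) - 1 / (u + 1))"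
    using m assms M
    by (simp add: totient_weight_eq[of m u] totient_weight_eq[of "Suc m" "u + 1"] M_def)
      (simp add: algebra_simps add_divide_distrib)
  also have "\<dots> \<ge> (M * (M + 1) + 2) / 4 * (1 / u - 1 / (M + 1)) +
      ((M + 1) * (M + 2) + 2) / 4 * (1 / (M + 1) - 1 / (u + 1))"
    using totient_sum_ge[of m] totient_sum_ge[of "Suc m"] m M
    by (intro add_mono mult_right_mono) (auto simp: M_def field_simps)
  \<comment> \<open>The bound \<open>M (M + 1) / 4\<close> alone would fall short of 1/4 for
    \<open>0 < \<theta> < 1\<close>: this is the term \<open>- \<theta> * (M + 1)\<close>. The
    \<open>+ 2\<close> in \<open>totient_sum_ge\<close> supplies the other terms, which outweigh
    it.\<close>
  moreover have "(M * (M + 1) + 2) / 4 * (1 / u - 1 / (M + 1)) +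
      ((M + 1) * (M + 2) + 2) / 4 * (1 / (M + 1) - 1 / (u + 1)) - 1 / 4 =
      ((1 - \<theta>) * (2 * (M + 1 + \<theta>) - \<theta> * (M + 1)) + 2 * \<theta> * (M + \<theta>)) / (4 * (M + \<theta>) * (M + 1) * (M + 1 + \<theta>))"
    using M \<theta> unfolding u by (simp add: divide_simps) (simp add: algebra_simps)
  moreover have "((1 - \<theta>) * (2 * (M + 1 + \<theta>) - \<theta> * (M + 1)) + 2 * \<theta> * (M + \<theta>)) / (4 * (M + \<theta>) * (M + 1) * (M + 1 + \<theta>)) \<ge> 0"
  proof -
    have "\<theta> * (M + 1) \<le> 1 * (M + 1)" using \<theta> M by (intro mult_right_mono) auto
    moreover have "1 * (M + 1) \<le> 2 * (M + 1 + \<theta>)" using \<theta> M by simp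
    ultimately have "2 * (M + 1 + \<theta>) - \<theta> * (M + 1) \<ge> 0" by simp
    then show ?thesis using \<theta> M by (intro divide_nonneg_nonneg add_nonneg_nonneg mult_nonneg_nonneg) auto
  qed
  ultimately show ?thesis by linarith
qed

lemma totient_weight_add_nat:
  assumes "u \<ge> 1"
  shows "totient_weight (u + real k) \<ge> totient_weight u + real k / 4"
proof (induction k)
  case (Suc k)
  then show ?case using totient_weight_add_1[of "u + real k"] assms
    by (simp add: add_ac add_divide_distrib)
qed simp

lemma totient_weight_1_2: "1 \<le> v \<Longrightarrow> v \<le> 2 \<Longrightarrow> totient_weight v = 1 - 1 / v"
  using totient_weight_eq[of 1 v] by (simp add: totient_sum_def)

lemma totient_weight_2_3: "2 \<le> v \<Longrightarrow> v \<le> 3 \<Longrightarrow> totient_weight v = 3/2 - 2 / v"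
proof -
  have "totient 2 = 1" using totient_prime[OF two_is_prime_nat] by simp
  then show "2 \<le> v \<Longrightarrow> v \<le> 3 \<Longrightarrow> ?thesis"
    using totient_weight_eq[of 2 v] by (simp add: totient_sum_def numeral_2_eq_2)
qed

text \<open>Shift by an integer into \<open>[2, 3]\<close>; there the claim is
  \<open>(w - 2) * (4 - w) \<ge> 0\<close>, with equality at \<open>w = 2\<close>.\<close>

lemma totient_weight_ge:
  assumes "v \<ge> 2"
  shows "totient_weight v \<ge> v / 4"
proof -
  define k where "k = nat \<lfloor>v - 2\<rfloor>"
  define w where "w = v - real k"
  have w: "2 \<le> w" "w \<le> 3" using assms unfolding w_def k_def by linarith+
  have "(w - 2) * (4 - w) \<ge> 0" using w by (intro mult_nonneg_nonneg) auto
  then have "w / 4 \<le> 3/2 - 2 / w" using w by (simp add: field_simps)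
  then show ?thesis
    using totient_weight_2_3[OF w] totient_weight_add_nat[of w k] w by (simp add: w_def)
qed

text \<open>Meant for an interval with \<open>p / q\<close> inside, \<open>t\<close> and
  \<open>t'\<close> being the rescaled lengths on its two sides. If the shorter one is at most 1,
  the other is at least 2 and suffices alone. If both lie in \<open>[1, 2]\<close>, the chord bound
  \<open>low\<close> for the concave \<open>1 - 1 / v\<close> gives \<open>(s - 2) / 2\<close>,
  which is enough because \<open>s \<ge> 3\<close>.\<close>

lemma totient_weight_straddle:
  assumes "s \<ge> 3" "t > 0" "t' > 0" "t + t' = s"
  shows "totient_weight t + totient_weight t' \<ge> (s - 1) / 4"
proof -
  have low: "totient_weight x \<ge> (x - 1) / 2" if "1 \<le> x" "x \<le> 2" for x
  proof -
    have "(x - 1) * (2 - x) \<ge> 0" using that by (intro mult_nonneg_nonneg) auto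
    then show ?thesis using that by (simp add: totient_weight_1_2 field_simps)
  qed
  have "totient_weight t + totient_weight t' \<ge> (s - 1) / 4"
    if "t \<le> t'" "t > 0" "t + t' = s" for t t'
  proof (cases "t \<le> 1")
    case True
    then have "totient_weight t' \<ge> t' / 4" using that assms by (intro totient_weight_ge) auto
    then show ?thesis using totient_weight_nonneg[of t] True that by (simp add: field_simps)
  next
    case False
    show ?thesis
    proof (cases "t' \<ge> 2")
      case True
      have "totient_weight t \<ge> (t - 1) / 4"
        using low[of t] totient_weight_ge[of t] False by (cases "t \<le> 2") auto
      then show ?thesis using totient_weight_ge[OF True] that by (simp add: field_simps)
    next
      case False
      with \<open>\<not> t \<le> 1\<close> that have "totient_weight t \<ge> (t - 1) / 2" "totient_weight t' \<ge> (t' - 1) / 2"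
        by (intro low; linarith)+
      then show ?thesis using that assms by (simp add: field_simps)
    qed
  qed
  from this[of t t'] this[of t' t] show ?thesis using assms by (cases "t \<le> t'") auto
qed

subsection \<open>Counting primitive points in a cone\<close>

text \<open>Legendre's sieve: the multiples of a new prime \<open>p\<close> pose the same problem on
  the interval divided by \<open>p\<close>, which multiplies the main term by
  \<open>1 - 1 / p\<close> and doubles the error bound. Hence \<open>u\<close> and \<open>v\<close>
  are real and vary in the induction.\<close>

lemma sieve_interval:
  fixes P :: "nat set" and u v :: real
  assumes "finite P" "\<And>p. p \<in> P \<Longrightarrow> prime p" "u \<le> v"
  shows "\<bar>real (card {k::int. u < of_int k \<and> of_int k \<le> v \<and> (\<forall>p\<in>P. \<not> int p dvd k)})
           - (v - u) * (\<Prod>p\<in>P. 1 - 1 / real p)\<bar> \<le> 2 ^ card P"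
  using assms
proof (induction P arbitrary: u v rule: finite_induct)
  case empty
  have "{k::int. u < of_int k \<and> of_int k \<le> v} = {\<lfloor>u\<rfloor><..\<lfloor>v\<rfloor>}"
    by (auto simp: le_floor_iff floor_less_iff)
  moreover have "\<lfloor>u\<rfloor> \<le> \<lfloor>v\<rfloor>" using empty by (intro floor_mono) auto
  ultimately have "real (card {k::int. u < of_int k \<and> of_int k \<le> v}) = of_int \<lfloor>v\<rfloor> - of_int \<lfloor>u\<rfloor>"
    by simp
  then show ?case by simp linarith
next
  case (insert p P)
  define A where "A = (\<lambda>P (u::real) (v::real). {k::int. u < of_int k \<and> of_int k \<le> v \<and> (\<forall>p\<in>P. \<not> int p dvd k)})"
  define \<pi> where "\<pi> = (\<Prod>p\<in>P. 1 - 1 / real p)"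
  have p: "prime p" "real p > 0" using insert.prems by (auto simp: prime_gt_0_nat)
  have fin: "finite (A Q x y)" for Q x y
  proof (rule finite_subset)
    show "A Q x y \<subseteq> {\<lfloor>x\<rfloor>..\<lfloor>y\<rfloor>}" by (auto simp: A_def le_floor_iff floor_le_iff)
  qed auto
  have dvd_iff: "int r dvd int p * k \<longleftrightarrow> int r dvd k" if "r \<in> P" for r k
  proof -
    have "prime r" "r \<noteq> p" using that insert by auto
    then have "coprime r p" using p by (simp add: primes_coprime)
    then have "coprime (int r) (int p)" by simp
    then show ?thesis by (simp add: coprime_dvd_mult_right_iff)
  qed
  (* Elements divisible by p correspond to elements of the interval scaled by 1/p. *)
  have "A P u v = A (insert p P) u v \<union> (\<lambda>k. int p * k) ` A P (u / real p) (v / real p)"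
  proof (intro equalityI subsetI)
    fix k assume k: "k \<in> A P u v"
    show "k \<in> A (insert p P) u v \<union> (\<lambda>k. int p * k) ` A P (u / real p) (v / real p)"
    proof (cases "int p dvd k")
      case True
      then obtain l where l: "k = int p * l" by (elim dvdE)
      then have "l \<in> A P (u / real p) (v / real p)"
        using k p dvd_iff by (auto simp: A_def field_simps)
      then show ?thesis using l by blast
    next
      case False
      then show ?thesis using k by (auto simp: A_def)
    qed
  next
    fix k assume "k \<in> A (insert p P) u v \<union> (\<lambda>k. int p * k) ` A P (u / real p) (v / real p)"
    then show "k \<in> A P u v" using p dvd_iff by (auto simp: A_def field_simps)
  qed
  moreover have "A (insert p P) u v \<inter> (\<lambda>k. int p * k) ` A P (u / real p) (v / real p) = {}"
    by (auto simp: A_def)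
  ultimately have "card (A P u v) = card (A (insert p P) u v) + card ((\<lambda>k. int p * k) ` A P (u / real p) (v / real p))"
    using fin by (simp add: card_Un_disjoint)
  also have "card ((\<lambda>k. int p * k) ` A P (u / real p) (v / real p)) = card (A P (u / real p) (v / real p))"
    by (rule card_image) (use p in \<open>auto simp: inj_on_def\<close>)
  finally have card: "real (card (A (insert p P) u v)) = real (card (A P u v)) - real (card (A P (u / real p) (v / real p)))"
    by simp
  have "\<bar>real (card (A P u v)) - (v - u) * \<pi>\<bar> \<le> 2 ^ card P"
    unfolding A_def \<pi>_def by (rule insert.IH) (use insert.prems in auto)
  moreover have "\<bar>real (card (A P (u / real p) (v / real p))) - (v / real p - u / real p) * \<pi>\<bar> \<le> 2 ^ card P"
    unfolding A_def \<pi>_def by (rule insert.IH) (use insert.prems p in \<open>auto simp: divide_right_mono\<close>)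
  moreover have "(v - u) * ((1 - 1 / real p) * \<pi>) = (v - u) * \<pi> - (v / real p - u / real p) * \<pi>"
    by (simp add: algebra_simps diff_divide_distrib)
  moreover have "(\<Prod>p\<in>insert p P. 1 - 1 / real p) = (1 - 1 / real p) * \<pi>"
    using insert.hyps by (simp add: \<pi>_def)
  ultimately have "\<bar>real (card (A (insert p P) u v)) - (v - u) * (\<Prod>p\<in>insert p P. 1 - 1 / real p)\<bar> \<le> 2 * 2 ^ card P"
    unfolding card by (simp only:) linarith
  then show ?case using insert.hyps by (simp add: A_def)
qed

text \<open>Squared form of a bound for the sieve error \<open>2 ^ card P\<close>. The constant
  \<open>2 * 4/3\<close> is rounded up to 4 so that its square root is 2.\<close>

lemma four_power_card_primes_le:
  fixes P :: "nat set"
  assumes "finite P" "\<And>p. p \<in> P \<Longrightarrow> prime p"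
  shows "4 ^ card P \<le> 4 * (\<Prod>p\<in>P. real p)"
proof -
  (* Only the primes below 4 contribute a factor 4/p greater than 1. *)
  have "4 ^ card P \<le> (if 2 \<in> P then 2 else 1) * (if 3 \<in> P then 4/3 else 1) * (\<Prod>p\<in>P. real p)"
    using assms
  proof (induction P rule: finite_induct)
    case (insert p P)
    define c where "c = (if 2 \<in> P then 2 else 1) * (if 3 \<in> P then 4/3 else (1::real))"
    have IH: "4 ^ card P \<le> c * (\<Prod>p\<in>P. real p)" using insert by (auto simp: c_def)
    have nonneg: "c * (\<Prod>p\<in>P. real p) \<ge> 0" by (auto simp: c_def intro!: mult_nonneg_nonneg prod_nonneg)
    consider "p = 2" | "p = 3" | "p \<ge> 4" using prime_ge_2_nat[of p] insert.prems by fastforce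
    then show ?case
    proof cases
      case 3
      have "4 * (4 ^ card P) \<le> real p * (c * (\<Prod>p\<in>P. real p))"
        using 3 IH by (intro mult_mono) auto
      then show ?thesis using 3 insert.hyps by (simp add: c_def mult_ac)
    qed (use IH insert.hyps in \<open>auto simp: c_def\<close>)
  qed simp
  also have "\<dots> \<le> 4 * (\<Prod>p\<in>P. real p)"
    by (intro mult_right_mono prod_nonneg) auto
  finally show ?thesis .
qed

text \<open>The product of the distinct prime factors is at most \<open>j\<close>; take square roots
  in \<open>four_power_card_primes_le\<close>.\<close>

lemma two_power_card_prime_factors_le:
  assumes "j > 0"
  shows "2 ^ card (prime_factors j) \<le> 2 * sqrt (real j)"
proof -
  have "(\<Prod>p\<in>prime_factors j. p) \<le> (\<Prod>p\<in>prime_factors j. p ^ multiplicity p j)"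
    by (rule prod_mono) (auto simp: prime_factors_multiplicity dest: prime_ge_1_nat intro!: self_le_power)
  also have "\<dots> = j" using prime_factorization_nat[OF assms] by simp
  finally have "(\<Prod>p\<in>prime_factors j. real p) \<le> real j" by (simp flip: of_nat_prod)
  then have "4 ^ card (prime_factors j) \<le> 4 * real j"
    using four_power_card_primes_le[of "prime_factors j"] by (auto simp: in_prime_factors_imp_prime)
  moreover have "(4::real) ^ card (prime_factors j) = (2 ^ card (prime_factors j))\<^sup>2"
    by (simp add: power_mult[symmetric] mult.commute[of _ 2]) (simp add: power_mult)
  ultimately have "2 ^ card (prime_factors j) \<le> sqrt (4 * real j)"
    by (intro real_le_rsqrt) simp
  then show ?thesis by (simp add: real_sqrt_mult)
qed

lemma coprime_int_iff_prime_factors: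
  fixes k :: int
  assumes "j \<noteq> 0"
  shows "coprime k j \<longleftrightarrow> (\<forall>p\<in>prime_factors (nat \<bar>j\<bar>). \<not> int p dvd k)"
proof
  assume cop: "coprime k j"
  show "\<forall>p\<in>prime_factors (nat \<bar>j\<bar>). \<not> int p dvd k"
  proof (intro ballI notI)
    fix p assume p: "p \<in> prime_factors (nat \<bar>j\<bar>)" "int p dvd k"
    then have "int p dvd j" by (auto simp: in_prime_factors_iff int_dvd_int_iff[symmetric] simp del: int_dvd_int_iff)
    with cop p have "is_unit (int p)" by (meson coprime_common_divisor)
    moreover have "prime p" using p by auto
    ultimately show False by auto
  qed
next
  assume *: "\<forall>p\<in>prime_factors (nat \<bar>j\<bar>). \<not> int p dvd k"
  show "coprime k j"
  proof (rule ccontr)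
    assume "\<not> coprime k j"
    then have "nat (gcd k j) \<noteq> 1" by (auto simp: coprime_iff_gcd_eq_1 nat_eq_iff)
    then obtain p where p: "prime p" "p dvd nat (gcd k j)" using prime_factor_nat by blast
    then have "int p dvd gcd k j" by (simp add: nat_dvd_iff int_dvd_int_iff[symmetric] del: int_dvd_int_iff)
    then have "int p dvd k" "int p dvd j" by auto
    then have "p \<in> prime_factors (nat \<bar>j\<bar>)"
      using p assms by (auto simp: in_prime_factors_iff int_dvd_int_iff[symmetric] simp del: int_dvd_int_iff)
    with * \<open>int p dvd k\<close> show False by blast
  qed
qed

section \<open>Primitive points on a line\<close>

definition primitive_line :: "int \<Rightarrow> int \<Rightarrow> int \<Rightarrow> real \<Rightarrow> real \<Rightarrow> (int \<times> int) set" where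
  "primitive_line p q j u v =
     {(X, Y). coprime X Y \<and> q * X - p * Y = j \<and> u < of_int Y \<and> of_int Y \<le> v}"

text \<open>On the line \<open>Y\<close> moves in steps of \<open>q\<close>, so
  \<open>(u, v]\<close> becomes an interval of length \<open>(v - u) / q\<close> for the parameter
  \<open>k\<close>, sieved by the primes dividing \<open>j\<close>. The product of
  \<open>1 - 1 / p\<close> over them is the totient quotient.\<close>

lemma
  assumes "coprime p q" "q > 0" "j \<noteq> 0" "u \<le> v"
  shows finite_primitive_line: "finite (primitive_line p q j u v)"
    and card_primitive_line: "\<bar>real (card (primitive_line p q j u v)) -
      (v - u) / of_int q * (real (totient (nat \<bar>j\<bar>)) / of_int \<bar>j\<bar>)\<bar> \<le> 2 * sqrt (of_int \<bar>j\<bar>)"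
proof -
  obtain r s where "r * p + s * q = 1" using bezout_int[of p q] assms by auto
  then obtain p' q' where one: "q * p' - p * q' = 1" by (metis diff_minus_eq_add mult.commute add.commute mult_minus_right)
  (* k = p' Y - q' X is the second coordinate for the basis (p', q'), (p, q) of the lattice,
     in which coprimality of (X, Y) becomes coprimality of k and j. *)
  define K where "K = {k. (u - of_int (j * q')) / of_int q < of_int k \<and>
    of_int k \<le> (v - of_int (j * q')) / of_int q \<and> (\<forall>p\<in>prime_factors (nat \<bar>j\<bar>). \<not> int p dvd k)}"
  have "K \<subseteq> {\<lfloor>(u - of_int (j * q')) / of_int q\<rfloor>..\<lfloor>(v - of_int (j * q')) / of_int q\<rfloor>}"
    by (auto simp: K_def le_floor_iff floor_le_iff)
  then have "finite K" using finite_subset by blast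
  have cop: "coprime (j * p' + k * p) (j * q' + k * q) \<longleftrightarrow> coprime k j" for k
  proof -
    have j: "j = q * (j * p' + k * p) - p * (j * q' + k * q)"
      using arg_cong[OF one, of "\<lambda>x. j * x"] by (simp add: algebra_simps)
    have k: "k = p' * (j * q' + k * q) - q' * (j * p' + k * p)"
      using arg_cong[OF one, of "\<lambda>x. k * x"] by (simp add: algebra_simps)
    have "d dvd j * p' + k * p \<and> d dvd j * q' + k * q \<longleftrightarrow> d dvd k \<and> d dvd j" for d
    proof
      assume "d dvd j * p' + k * p \<and> d dvd j * q' + k * q"
      then have "d dvd p' * (j * q' + k * q) - q' * (j * p' + k * p)"
        "d dvd q * (j * p' + k * p) - p * (j * q' + k * q)"
        by (auto intro: dvd_diff dvd_mult)
      then show "d dvd k \<and> d dvd j" by (simp only: j[symmetric] k[symmetric])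
    qed auto
    then show ?thesis unfolding coprime_def by blast
  qed
  have bij: "bij_betw (\<lambda>k. (j * p' + k * p, j * q' + k * q)) K (primitive_line p q j u v)"
  proof (rule bij_betw_byWitness[where f' = "\<lambda>(X, Y). p' * Y - q' * X"])
    show "\<forall>k\<in>K. (\<lambda>(X, Y). p' * Y - q' * X) (j * p' + k * p, j * q' + k * q) = k"
    proof
      fix k show "(\<lambda>(X, Y). p' * Y - q' * X) (j * p' + k * p, j * q' + k * q) = k"
        using arg_cong[OF one, of "\<lambda>x. k * x"] by (simp add: algebra_simps)
    qed
    have inv: "j * p' + (p' * Y - q' * X) * p = X \<and> j * q' + (p' * Y - q' * X) * q = Y"
      if "q * X - p * Y = j" for X Y
      unfolding that[symmetric]
      using arg_cong[OF one, of "\<lambda>x. X * x"] arg_cong[OF one, of "\<lambda>x. Y * x"] by (simp add: algebra_simps)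
    then show "\<forall>z\<in>primitive_line p q j u v.
        (j * p' + (case z of (X, Y) \<Rightarrow> p' * Y - q' * X) * p, j * q' + (case z of (X, Y) \<Rightarrow> p' * Y - q' * X) * q) = z"
      by (auto simp: primitive_line_def)
    have range: "(u - of_int (j * q')) / of_int q < of_int k \<and> of_int k \<le> (v - of_int (j * q')) / of_int q \<longleftrightarrow>
        u < of_int (j * q' + k * q) \<and> of_int (j * q' + k * q) \<le> v" for k
      using assms(2) by (simp add: field_simps)
    show "(\<lambda>k. (j * p' + k * p, j * q' + k * q)) ` K \<subseteq> primitive_line p q j u v"
    proof
      fix z assume "z \<in> (\<lambda>k. (j * p' + k * p, j * q' + k * q)) ` K"
      then obtain k where z: "z = (j * p' + k * p, j * q' + k * q)" and k: "k \<in> K" by blast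
      have "q * (j * p' + k * p) - p * (j * q' + k * q) = j"
        using arg_cong[OF one, of "\<lambda>x. j * x"] by (simp add: algebra_simps)
      then show "z \<in> primitive_line p q j u v"
        using k unfolding z K_def mem_Collect_eq conj_assoc[symmetric] range
          coprime_int_iff_prime_factors[OF assms(3), symmetric]
        by (auto simp: primitive_line_def cop)
    qed
    show "(\<lambda>(X, Y). p' * Y - q' * X) ` primitive_line p q j u v \<subseteq> K"
    proof (clarsimp simp: primitive_line_def)
      fix X Y assume XY: "coprime X Y" "j = q * X - p * Y" "u < real_of_int Y" "real_of_int Y \<le> v"
      have "coprime (p' * Y - q' * X) j"
        using cop[of "p' * Y - q' * X"] inv[of X Y] XY by simp
      then show "p' * Y - q' * X \<in> K"
        using XY inv[of X Y] unfolding K_def mem_Collect_eq conj_assoc[symmetric] range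
          coprime_int_iff_prime_factors[OF assms(3), symmetric]
        by simp
    qed
  qed
  then show "finite (primitive_line p q j u v)" using \<open>finite K\<close> bij_betw_finite by blast
  have card_K: "card K = card (primitive_line p q j u v)" using bij by (rule bij_betw_same_card)
  define m where "m = nat \<bar>j\<bar>"
  have m: "m > 0" "real m = of_int \<bar>j\<bar>" using assms by (auto simp: m_def)
  have "\<bar>real (card K) - ((v - of_int (j * q')) / of_int q - (u - of_int (j * q')) / of_int q) *
      (\<Prod>p\<in>prime_factors m. 1 - 1 / real p)\<bar> \<le> 2 ^ card (prime_factors m)"
    unfolding K_def m_def
    by (rule sieve_interval) (use assms in \<open>auto intro!: divide_right_mono\<close>)
  also have "(v - of_int (j * q')) / of_int q - (u - of_int (j * q')) / of_int q = (v - u) / of_int q"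
    by (simp add: diff_divide_distrib)
  also have "(\<Prod>p\<in>prime_factors m. 1 - 1 / real p) = real (totient m) / real m"
    using m by (simp add: totient_formula2)
  also have "2 ^ card (prime_factors m) \<le> 2 * sqrt (real m)"
    by (rule two_power_card_prime_factors_le[OF m(1)])
  finally show "\<bar>real (card (primitive_line p q j u v)) -
      (v - u) / of_int q * (real (totient (nat \<bar>j\<bar>)) / of_int \<bar>j\<bar>)\<bar> \<le> 2 * sqrt (of_int \<bar>j\<bar>)"
    unfolding m(2) card_K m_def[symmetric] .
qed

section \<open>Primitive points in a cone\<close>

text \<open>
  The sign \<open>\<sigma> = \<plusminus>1\<close> selects the side of \<open>p/q\<close>; in terms of \<open>j = \<sigma> (q X - p Y)\<close>, the distance from
  \<open>p/q\<close> to \<open>X/Y\<close> is \<open>j/(q Y)\<close>, and the last condition says that it is less than \<open>v/(q n)\<close>.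
\<close>

definition primitive_cone :: "int \<Rightarrow> int \<Rightarrow> int \<Rightarrow> nat \<Rightarrow> real \<Rightarrow> (int \<times> int) set" where
  "primitive_cone p q \<sigma> n v =
     {(X, Y). coprime X Y \<and> 0 < Y \<and> Y \<le> int n \<and> 0 < \<sigma> * (q * X - p * Y) \<and>
        of_int (\<sigma> * (q * X - p * Y)) * real n < v * of_int Y}"

text \<open>The cone splits into lines with \<open>1 \<le> j \<le> v\<close>:
  \<open>j n < v Y\<close> and \<open>Y \<le> n\<close> force \<open>j < v\<close>, and
  \<open>Y\<close> runs over \<open>(j n / v, n]\<close>. The main terms add up to the weight; each
  of at most \<open>v\<close> lines errs by at most \<open>2 * sqrt v\<close>.\<close>

lemma
  assumes "coprime p q" "q > 0" "\<bar>\<sigma>\<bar> = 1" "v \<ge> 0" "n > 0"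
  shows finite_primitive_cone: "finite (primitive_cone p q \<sigma> n v)"
    and card_primitive_cone: "\<bar>real (card (primitive_cone p q \<sigma> n v)) - real n / of_int q * totient_weight v\<bar>
      \<le> 2 * v * sqrt v"
proof -
  define J where "J = {1..nat \<lfloor>v\<rfloor>}"
  define L where "L = (\<lambda>j. primitive_line p q (\<sigma> * int j) (real j * real n / v) (real n))"
  have J: "real j \<le> v" "0 < j" "v > 0" if "j \<in> J" for j
    using that by (auto simp: J_def) linarith+
  have \<sigma>: "\<sigma> * \<sigma> = 1" "\<sigma> \<noteq> 0" using assms(3) by (auto simp: abs_if split: if_splits)
  have le: "real j * real n / v \<le> real n" if "j \<in> J" for j
    using J[OF that] assms by (simp add: field_simps mult_left_mono)
  have eq: "primitive_cone p q \<sigma> n v = (\<Union>j\<in>J. L j)"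
  proof (intro equalityI subsetI)
    fix z assume z: "z \<in> primitive_cone p q \<sigma> n v"
    obtain X Y where XY: "z = (X, Y)" by force
    define j where "j = nat (\<sigma> * (q * X - p * Y))"
    have j: "int j = \<sigma> * (q * X - p * Y)" "j > 0" using z by (auto simp: primitive_cone_def XY j_def)
    have sj: "\<sigma> * int j = q * X - p * Y" unfolding j using \<sigma> by (simp flip: mult.assoc)
    have lt: "real j * real n < v * of_int Y" "Y \<le> int n" "0 < Y" "coprime X Y"
      using z unfolding primitive_cone_def XY mem_Collect_eq prod.case j(1)[symmetric] by simp_all
    have "0 \<le> real j * real n" by simp
    then have "v * of_int Y > 0" using lt(1) by (rule le_less_trans)
    then have v: "v > 0" using lt(3) by (simp add: zero_less_mult_iff)
    have "real_of_int Y \<le> real n" using lt(2) by linarith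
    then have "v * of_int Y \<le> v * real n" using v by (intro mult_left_mono) auto
    then have "real j * real n < v * real n" using lt by linarith
    then have "real j < v" using assms by simp
    then have "j \<le> nat \<lfloor>v\<rfloor>" by linarith
    then have "j \<in> J" using j(2) by (simp add: J_def)
    moreover have "z \<in> L j"
      using lt v \<open>real_of_int Y \<le> real n\<close> sj by (auto simp: L_def primitive_line_def XY field_simps)
    ultimately show "z \<in> (\<Union>j\<in>J. L j)" by blast
  next
    fix z assume "z \<in> (\<Union>j\<in>J. L j)"
    then obtain j where j: "j \<in> J" "z \<in> L j" by blast
    obtain X Y where XY: "z = (X, Y)" by force
    have *: "coprime X Y" "q * X - p * Y = \<sigma> * int j" "real j * real n / v < of_int Y" "of_int Y \<le> real n"
      using j(2) by (auto simp: L_def primitive_line_def XY)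
    have "\<sigma> * (q * X - p * Y) = int j" unfolding * using \<sigma> by (simp flip: mult.assoc)
    moreover have "real j * real n < v * of_int Y" using *(3) J[OF j(1)] by (simp add: field_simps)
    moreover have "0 \<le> real j * real n / v" using J[OF j(1)] by simp
    then have "real_of_int Y > 0" using *(3) by linarith
    then have "Y > 0" by simp
    moreover have "Y \<le> int n" using *(4) by linarith
    ultimately show "z \<in> primitive_cone p q \<sigma> n v"
      using *(1) J[OF j(1)] unfolding primitive_cone_def XY mem_Collect_eq prod.case by simp
  qed
  have finL: "finite (L j)" if "j \<in> J" for j
    unfolding L_def using assms \<sigma> J[OF that] le[OF that] by (intro finite_primitive_line) auto
  then show "finite (primitive_cone p q \<sigma> n v)" unfolding eq by (auto simp: J_def)
  have "card (primitive_cone p q \<sigma> n v) = (\<Sum>j\<in>J. card (L j))"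
    unfolding eq
  proof (rule card_UN_disjoint)
    show "\<forall>i\<in>J. \<forall>j\<in>J. i \<noteq> j \<longrightarrow> L i \<inter> L j = {}"
      using \<sigma> by (auto simp: L_def primitive_line_def)
  qed (use finL in \<open>auto simp: J_def\<close>)
  moreover have "real n / of_int q * totient_weight v =
      (\<Sum>j\<in>J. (real n - real j * real n / v) / of_int q * (real (totient j) / real j))"
    unfolding totient_weight_def sum_distrib_left J_def[symmetric]
  proof (rule sum.cong)
    fix j assume "j \<in> J"
    then show "real n / of_int q * (real (totient j) * (1 / real j - 1 / v)) =
        (real n - real j * real n / v) / of_int q * (real (totient j) / real j)"
      using J[of j] assms(2) by (simp add: field_simps)
  qed simp
  ultimately have "\<bar>real (card (primitive_cone p q \<sigma> n v)) - real n / of_int q * totient_weight v\<bar> =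
      \<bar>\<Sum>j\<in>J. real (card (L j)) - (real n - real j * real n / v) / of_int q * (real (totient j) / real j)\<bar>"
    by (simp add: sum_subtractf)
  also have "\<dots> \<le> (\<Sum>j\<in>J. \<bar>real (card (L j)) - (real n - real j * real n / v) / of_int q * (real (totient j) / real j)\<bar>)"
    by (rule sum_abs)
  also have "\<dots> \<le> (\<Sum>j\<in>J. 2 * sqrt v)"
  proof (rule sum_mono)
    fix j assume j: "j \<in> J"
    have abs: "\<bar>\<sigma> * int j\<bar> = int j" using assms(3) by (simp add: abs_mult)
    have "\<bar>real (card (L j)) - (real n - real j * real n / v) / of_int q * (real (totient j) / real j)\<bar> \<le> 2 * sqrt (real j)"
      using card_primitive_line[of p q "\<sigma> * int j" "real j * real n / v" "real n"] assms \<sigma> J[OF j] le[OF j]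
      unfolding abs by (simp add: L_def)
    also have "\<dots> \<le> 2 * sqrt v" using J[OF j] by simp
    finally show "\<bar>real (card (L j)) - (real n - real j * real n / v) / of_int q * (real (totient j) / real j)\<bar> \<le> 2 * sqrt v" .
  qed
  also have "\<dots> = real (nat \<lfloor>v\<rfloor>) * (2 * sqrt v)" by (simp add: J_def)
  also have "\<dots> \<le> v * (2 * sqrt v)" using assms by (intro mult_right_mono) auto
  finally show "\<bar>real (card (primitive_cone p q \<sigma> n v)) - real n / of_int q * totient_weight v\<bar>
      \<le> 2 * v * sqrt v" by (simp add: mult_ac)
qed

subsection \<open>Primitive points in a short interval\<close>

text \<open>Fractions in lowest terms kept as lattice points. Both ends are included, which counts
  at most two points too many.\<close>

definition primitive_between :: "nat \<Rightarrow> real \<Rightarrow> real \<Rightarrow> (int \<times> int) set" where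
  "primitive_between n x y = {(X, Y). coprime X Y \<and> 0 < Y \<and> Y \<le> int n \<and>
     x \<le> of_int X / of_int Y \<and> of_int X / of_int Y \<le> y}"

lemma finite_primitive_between: "finite (primitive_between n x y)"
proof (rule finite_subset)
  define M where "M = \<bar>x\<bar> + \<bar>y\<bar>"
  have bound: "\<bar>X\<bar> \<le> \<lceil>M * real n\<rceil>"
    if "0 < Y" "Y \<le> int n" "x \<le> of_int X / of_int Y" "of_int X / of_int Y \<le> y" for X Y
  proof -
    have Y: "0 < real_of_int Y" "real_of_int Y \<le> real n" using that by linarith+
    have "\<bar>r\<bar> \<le> M" if "x \<le> r" "r \<le> y" for r using that unfolding M_def by arith
    then have "\<bar>of_int X / of_int Y\<bar> \<le> M" using that by blast
    then have "\<bar>of_int X\<bar> \<le> M * of_int Y" using Y by (simp add: field_simps)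
    also have "\<dots> \<le> M * real n" using Y by (intro mult_left_mono) (auto simp: M_def)
    also have "\<dots> \<le> of_int \<lceil>M * real n\<rceil>" by (rule le_of_int_ceiling)
    finally show ?thesis by (simp flip: of_int_abs)
  qed
  show "primitive_between n x y \<subseteq> {- \<lceil>M * real n\<rceil>..\<lceil>M * real n\<rceil>} \<times> {0..int n}"
  proof
    fix z assume z: "z \<in> primitive_between n x y"
    obtain X Y where "z = (X, Y)" by force
    then show "z \<in> {- \<lceil>M * real n\<rceil>..\<lceil>M * real n\<rceil>} \<times> {0..int n}"
      using bound[of Y X] z by (simp add: primitive_between_def abs_le_iff)
  qed
qed simp

text \<open>For an interval on one side of \<open>p / q\<close>, which contains a difference of two
  cones. The gain \<open>q / 4\<close> in weight cancels the factor \<open>1 / q\<close>, and each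
  cone errs by at most \<open>2 * c * sqrt c\<close>.\<close>

lemma card_primitive_between_ge_diff:
  assumes "coprime p q" "q > 0" "\<bar>\<sigma>\<bar> = 1" "n > 0" "0 \<le> w" "w \<le> v" "v \<le> c"
    and "totient_weight v - totient_weight w \<ge> of_int q / 4"
    and "primitive_cone p q \<sigma> n v - primitive_cone p q \<sigma> n w \<subseteq> primitive_between n x y"
  shows "real (card (primitive_between n x y)) \<ge> real n / 4 - 4 * c * sqrt c"
proof -
  let ?C = "primitive_cone p q \<sigma> n"
  have err: "2 * r * sqrt r \<le> 2 * c * sqrt c" if "0 \<le> r" "r \<le> c" for r
    using that by (intro mult_mono) auto
  have "\<bar>real (card (?C v)) - real n / of_int q * totient_weight v\<bar> \<le> 2 * v * sqrt v"
    "\<bar>real (card (?C w)) - real n / of_int q * totient_weight w\<bar> \<le> 2 * w * sqrt w"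
    by (rule card_primitive_cone; use assms in simp)+
  moreover have "card (?C v) - card (?C w) \<le> card (?C v - ?C w)"
    by (rule diff_card_le_card_Diff, rule finite_primitive_cone) (use assms in auto)
  moreover have "card (?C v - ?C w) \<le> card (primitive_between n x y)"
    using assms finite_primitive_between by (intro card_mono) auto
  moreover have "real n / of_int q * (of_int q / 4) \<le> real n / of_int q * (totient_weight v - totient_weight w)"
    using assms by (intro mult_left_mono) auto
  then have "real n / 4 \<le> real n / of_int q * totient_weight v - real n / of_int q * totient_weight w"
    using assms(2) by (simp add: right_diff_distrib)
  ultimately show ?thesis using err[of v] err[of w] assms by linarith
qed

text \<open>For an interval around \<open>p / q\<close>: the cones on its two sides are disjoint by
  the sign of \<open>q X - p Y\<close>, so their counts add.\<close>

lemma card_primitive_between_ge_sum: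
  assumes "coprime p q" "q > 0" "n > 0" "0 \<le> v" "v \<le> c" "0 \<le> w" "w \<le> c"
    and "totient_weight v + totient_weight w \<ge> of_int q / 4"
    and "primitive_cone p q 1 n v \<union> primitive_cone p q (-1) n w \<subseteq> primitive_between n x y"
  shows "real (card (primitive_between n x y)) \<ge> real n / 4 - 4 * c * sqrt c"
proof -
  let ?C = "primitive_cone p q"
  have err: "2 * r * sqrt r \<le> 2 * c * sqrt c" if "0 \<le> r" "r \<le> c" for r
    using that by (intro mult_mono) auto
  have "\<bar>real (card (?C 1 n v)) - real n / of_int q * totient_weight v\<bar> \<le> 2 * v * sqrt v"
    "\<bar>real (card (?C (-1) n w)) - real n / of_int q * totient_weight w\<bar> \<le> 2 * w * sqrt w"
    by (rule card_primitive_cone; use assms in simp)+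
  moreover have "card (?C 1 n v \<union> ?C (-1) n w) = card (?C 1 n v) + card (?C (-1) n w)"
    using assms by (intro card_Un_disjoint finite_primitive_cone) (auto simp: primitive_cone_def)
  moreover have "card (?C 1 n v \<union> ?C (-1) n w) \<le> card (primitive_between n x y)"
    using assms finite_primitive_between by (intro card_mono) auto
  moreover have "real n / of_int q * (of_int q / 4) \<le> real n / of_int q * (totient_weight v + totient_weight w)"
    using assms by (intro mult_left_mono) auto
  then have "real n / 4 \<le> real n / of_int q * totient_weight v + real n / of_int q * totient_weight w"
    using assms(2) by (simp add: distrib_left)
  ultimately show ?thesis using err[of v] err[of w] assms by linarith
qed

lemma card_primitive_between_ge:
  fixes x :: real and n :: nat
  defines "x' \<equiv> x + (1 + x) / (real n - 1)"
  assumes n: "n \<ge> 16" and x: "1 / real n \<le> x" and x': "x' \<le> 1"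
  shows "real (card (primitive_between n x x')) \<ge> real n / 4 - 4 * (4 * sqrt n) * sqrt (4 * sqrt n)"
proof -
  \<comment> \<open>This size keeps both \<open>s\<close> and \<open>\<bar>\<tau>\<bar>\<close>
    within \<open>2 * sqrt n\<close>, so \<open>4 * sqrt n\<close> bounds every cone parameter
    below.\<close>
  define Q where "Q = nat \<lfloor>sqrt n\<rfloor>"
  have sq: "sqrt (real n) \<ge> 4" using n by (simp add: real_le_rsqrt)
  have sq2: "sqrt (real n) * sqrt (real n) = real n" by simp
  have Q: "Q > 0" "real Q \<le> sqrt n" "sqrt n \<le> 2 * real Q" using sq unfolding Q_def by linarith+
  obtain p q where pq: "coprime p q" "0 < q" "q \<le> int Q" "\<bar>of_int q * x - of_int p\<bar> < 1 / real Q"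
    using Dirichlet_approx_coprime[OF Q(1)] by metis
  define \<tau> where "\<tau> = real n * (of_int q * x - of_int p)"
  define s where "s = (of_int p + of_int q :: real)"
  have npos: "real n > 1" using n by simp
  have xpos: "x > 0" using x npos less_le_trans[of 0 "1 / real n" x] by simp
  have "(1 + x) / (real n - 1) > 0" using xpos npos by simp
  then have x1: "x < 1" using x' unfolding x'_def by linarith
  have "1 / real Q \<le> 1" using Q by simp
  have "of_int p > (-1::real)"
  proof -
    have "of_int q * x > 0" using pq xpos by simp
    then show ?thesis using pq(4) \<open>1 / real Q \<le> 1\<close> by linarith
  qed
  then have p0: "p \<ge> 0" by linarith
  have "of_int p < (of_int q + 1 :: real)"
  proof -
    have "of_int q * x < of_int q * 1" using pq x1 by (intro mult_strict_left_mono) auto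
    then show ?thesis using pq(4) \<open>1 / real Q \<le> 1\<close> by linarith
  qed
  then have pq_le: "p \<le> q" by linarith
  have q_le: "of_int q \<le> sqrt n" using pq(3) Q(2) by linarith
  have s_le: "s \<le> 2 * sqrt n" using pq_le q_le unfolding s_def by linarith
  have \<tau>_le: "\<bar>\<tau>\<bar> \<le> 2 * sqrt n"
  proof -
    have "\<bar>\<tau>\<bar> = real n * \<bar>of_int q * x - of_int p\<bar>" by (simp add: \<tau>_def abs_mult)
    also have "\<dots> \<le> real n * (1 / real Q)" using pq(4) by (intro mult_left_mono) auto
    also have "\<dots> \<le> 2 * sqrt n"
      using mult_left_mono[OF Q(3), of "sqrt n"] sq2 Q(1) by (simp add: field_simps)
    finally show ?thesis .
  qed
  have x_eq: "x = (\<tau> / n + of_int p) / of_int q" using pq npos by (simp add: \<tau>_def field_simps)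
  \<comment> \<open>Since \<open>x' = (n x + 1) / (n - 1)\<close>, multiplying
    \<open>q x' - p\<close> by \<open>n - 1\<close> gives
    \<open>n (q x - p) + p + q\<close>.\<close>
  have x'_eq: "x' = ((\<tau> + s) / (real n - 1) + of_int p) / of_int q"
    unfolding x'_def s_def x_eq using pq npos by (simp add: field_simps)
  have frac: "of_int X / of_int Y = (of_int (q * X - p * Y) / of_int Y + of_int p) / (of_int q :: real)"
    if "Y > 0" for X Y
    using that pq by (simp add: field_simps)
  have cross: "(a / c + h) / k \<le> (b / d + h) / k \<longleftrightarrow> a * d \<le> b * c"
    if "c > 0" "d > 0" "k > 0" for a b c d h k :: real
  proof -
    have "(a / c + h) / k \<le> (b / d + h) / k \<longleftrightarrow> a / c \<le> b / d"
      using that by (simp add: divide_le_cancel)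
    also have "\<dots> \<longleftrightarrow> a * d \<le> b * c" using that by (simp add: field_simps)
    finally show ?thesis .
  qed
  \<comment> \<open>For a point with \<open>j = q X - p Y\<close> the two ends become
    \<open>\<tau> Y \<le> j n\<close> and \<open>j (n - 1) \<le> (\<tau> + s) Y\<close>. The second
    has \<open>n - 1\<close> where a cone condition has \<open>n\<close>.\<close>
  have ge_x: "x \<le> of_int X / of_int Y \<longleftrightarrow> \<tau> * of_int Y \<le> of_int (q * X - p * Y) * real n" if "Y > 0" for X Y
    unfolding frac[OF that, of X] x_eq by (rule cross) (use that pq npos in auto)
  have le_x': "of_int X / of_int Y \<le> x' \<longleftrightarrow>
      of_int (q * X - p * Y) * (real n - 1) \<le> (\<tau> + s) * of_int Y" if "Y > 0" for X Y
    unfolding frac[OF that, of X] x'_eq by (rule cross) (use that pq npos in auto)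
  have p_pos: "p > 0" if "\<tau> < 0"
  proof (rule ccontr)
    assume "\<not> p > 0"
    with p0 have "p = 0" by simp
    then show False using that pq xpos npos by (simp add: \<tau>_def mult_less_0_iff)
  qed
  have s_ge: "s \<ge> of_int q + 1" if "p > 0" using that unfolding s_def by linarith
  have q1: "of_int q \<ge> (1::real)" using pq(2) by linarith
  have add_q: "totient_weight (u + of_int q) \<ge> totient_weight u + of_int q / 4" if "u \<ge> 1" for u
    using totient_weight_add_nat[OF that, of "nat q"] pq(2) by simp
  (* x and x' both right of p/q; on opposite sides of p/q; both left of p/q (or x' = p/q). *)
  consider "\<tau> \<ge> 0" | "\<tau> < 0" "\<tau> + s > 0" | "\<tau> < 0" "\<tau> + s \<le> 0" by linarith
  then show ?thesis
  proof cases
    case 1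
    show ?thesis
    proof (rule card_primitive_between_ge_diff)
      show "primitive_cone p q 1 n (\<tau> + s) - primitive_cone p q 1 n \<tau> \<subseteq> primitive_between n x x'"
      proof clarify
        fix X Y assume XY: "(X, Y) \<in> primitive_cone p q 1 n (\<tau> + s)" "(X, Y) \<notin> primitive_cone p q 1 n \<tau>"
        then have *: "coprime X Y" "0 < Y" "Y \<le> int n" and j: "q * X - p * Y > 0"
          and lt: "of_int (q * X - p * Y) * real n < (\<tau> + s) * of_int Y"
          and ge: "\<tau> * of_int Y \<le> of_int (q * X - p * Y) * real n"
          by (auto simp: primitive_cone_def)
        \<comment> \<open>For \<open>j > 0\<close> the change from \<open>n\<close> to
          \<open>n - 1\<close> goes in the favourable direction.\<close>
        have "real_of_int (q * X - p * Y) * (real n - 1) \<le> of_int (q * X - p * Y) * real n"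
          using j by (intro mult_left_mono) (simp_all del: of_int_diff of_int_mult)
        then have "real_of_int (q * X - p * Y) * (real n - 1) \<le> (\<tau> + s) * of_int Y"
          using lt by linarith
        then show "(X, Y) \<in> primitive_between n x x'"
          using * ge by (simp add: primitive_between_def ge_x le_x' del: of_int_diff of_int_mult)
      qed
      show "totient_weight (\<tau> + s) - totient_weight \<tau> \<ge> of_int q / 4"
      proof (cases "\<tau> \<ge> 1")
        case True
        have "totient_weight (\<tau> + of_int q) \<le> totient_weight (\<tau> + s)"
          using p0 by (intro totient_weight_mono) (simp add: s_def)
        then show ?thesis using add_q[OF True] by linarith
      next
        case False
        \<comment> \<open>\<open>p = 0\<close> forces \<open>q = 1\<close> by coprimality, and then
          \<open>\<tau> = n x \<ge> 1\<close>. With \<open>p > 0\<close>,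
          \<open>s \<ge> q + 1 \<ge> 2\<close> makes \<open>totient_weight_ge\<close> applicable,
          while the weight at \<open>\<tau> < 1\<close> is zero.\<close>
        have "p \<noteq> 0"
        proof
          assume "p = 0"
          then have "q = 1" using pq by simp
          then have "\<tau> = real n * x" using \<open>p = 0\<close> by (simp add: \<tau>_def)
          also have "\<dots> \<ge> 1" using x npos by (simp add: field_simps)
          finally show False using False by simp
        qed
        then have s: "s \<ge> of_int q + 1" using p0 by (intro s_ge) simp
        then have "totient_weight (\<tau> + s) \<ge> (\<tau> + s) / 4"
          using q1 1 by (intro totient_weight_ge) linarith
        then show ?thesis using totient_weight_eq_0[of \<tau>] False 1 s by simp
      qed
    qed (use pq n 1 s_le \<tau>_le p0 in \<open>auto simp: s_def\<close>)
  next
    case 2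
    have p: "p > 0" by (rule p_pos) (use 2 in simp)
    show ?thesis
    proof (rule card_primitive_between_ge_sum)
      show "primitive_cone p q 1 n (\<tau> + s) \<union> primitive_cone p q (-1) n (- \<tau>) \<subseteq> primitive_between n x x'"
      proof clarify
        fix X Y assume XY: "(X, Y) \<in> primitive_cone p q 1 n (\<tau> + s) \<union> primitive_cone p q (-1) n (- \<tau>)"
        then have *: "coprime X Y" "0 < Y" "Y \<le> int n" by (auto simp: primitive_cone_def)
        define j where "j = real_of_int (q * X - p * Y)"
        \<comment> \<open>Each cone supplies one inequality; the other holds by signs, as
          \<open>\<tau> < 0 < \<tau> + s\<close>.\<close>
        have "\<tau> * of_int Y \<le> j * real n \<and> j * (real n - 1) \<le> (\<tau> + s) * of_int Y"
        proof (cases "(X, Y) \<in> primitive_cone p q 1 n (\<tau> + s)")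
          case True
          then have "q * X - p * Y > 0" and lt: "j * real n < (\<tau> + s) * of_int Y"
            by (auto simp: primitive_cone_def j_def)
          then have j: "j > 0" unfolding j_def of_int_0_less_iff by simp
          then have "\<tau> * of_int Y \<le> 0" "j * real n \<ge> 0" using 2 * by (auto simp: mult_le_0_iff)
          moreover have "j * (real n - 1) \<le> j * real n" using j by (intro mult_left_mono) auto
          ultimately show ?thesis using lt by linarith
        next
          case False
          then have "q * X - p * Y < 0" and lt: "- j * real n < - \<tau> * of_int Y"
            using XY by (auto simp: primitive_cone_def j_def)
          then have j: "j < 0" unfolding j_def of_int_less_0_iff by simp
          then have "j * (real n - 1) \<le> 0" using npos by (auto simp: mult_le_0_iff)
          moreover have "(\<tau> + s) * of_int Y \<ge> 0" using 2 * by simp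
          ultimately show ?thesis using lt by linarith
        qed
        then show "(X, Y) \<in> primitive_between n x x'"
          using * by (simp add: primitive_between_def ge_x le_x' j_def del: of_int_diff of_int_mult)
      qed
      \<comment> \<open>\<open>q = 1\<close> would mean \<open>p = 1\<close> and
        \<open>x' > 1\<close>. From \<open>q \<ge> 2\<close> comes the \<open>s \<ge> 3\<close> that
        \<open>totient_weight_straddle\<close> requires; its lost unit is paid by
        \<open>s \<ge> q + 1\<close>.\<close>
      have "q \<ge> 2"
      proof (rule ccontr)
        assume "\<not> q \<ge> 2"
        then have "p = 1" "q = 1" using p pq pq_le by auto
        then have "x' = (\<tau> + s) / (real n - 1) + 1" using x'_eq by simp
        then have "(\<tau> + s) / (real n - 1) \<le> 0" using x' by linarith
        then show False using 2 npos by (simp add: divide_le_0_iff)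
      qed
      then have "real_of_int q \<ge> 2" by linarith
      then have "s \<ge> 3" using s_ge[OF p] by linarith
      then have "totient_weight (\<tau> + s) + totient_weight (- \<tau>) \<ge> (s - 1) / 4"
        using 2 by (intro totient_weight_straddle) auto
      moreover have "(s - 1) / 4 \<ge> of_int q / 4" using s_ge[OF p] by simp
      ultimately show "totient_weight (\<tau> + s) + totient_weight (- \<tau>) \<ge> of_int q / 4"
        by (rule order_trans[rotated])
    qed (use pq n 2 s_le \<tau>_le p0 in \<open>auto simp: s_def\<close>)
  next
    case 3
    have p: "p > 0" by (rule p_pos) (use 3 in simp)
    (* Here rounding n/(n - 1) to 1 would point the wrong way, so w exceeds - \<tau> - s by up to 1. *)
    define w where "w = (- \<tau> - s) * real n / (real n - 1)"
    have w0: "w \<ge> 0" using 3 npos by (simp add: w_def)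
    \<comment> \<open>\<open>- \<tau> - s \<le> 2 * sqrt n \<le> n - 1\<close> limits the excess of
      \<open>w\<close> to 1, and \<open>s \<ge> q + 1\<close> absorbs it.\<close>
    have w_le: "w + of_int q \<le> - \<tau>"
    proof -
      have "4 * sqrt n \<le> sqrt n * sqrt n" using sq by (intro mult_right_mono) auto
      then have "2 * sqrt n \<le> real n - 1" using n unfolding sq2 by linarith
      moreover have "s \<ge> 0" using s_ge[OF p] q1 by linarith
      ultimately have "- \<tau> - s \<le> real n - 1" using \<tau>_le by linarith
      then have "(- \<tau> - s) / (real n - 1) \<le> 1" using npos by simp
      moreover have "w = (- \<tau> - s) + (- \<tau> - s) / (real n - 1)"
        using npos by (simp add: w_def field_simps)
      ultimately show ?thesis using s_ge[OF p] by linarith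
    qed
    show ?thesis
    proof (rule card_primitive_between_ge_diff)
      show "primitive_cone p q (-1) n (- \<tau>) - primitive_cone p q (-1) n w \<subseteq> primitive_between n x x'"
      proof clarify
        fix X Y assume XY: "(X, Y) \<in> primitive_cone p q (-1) n (- \<tau>)" "(X, Y) \<notin> primitive_cone p q (-1) n w"
        define j where "j = real_of_int (q * X - p * Y)"
        have *: "coprime X Y" "0 < Y" "Y \<le> int n" and lt: "- j * real n < - \<tau> * of_int Y"
          and ge: "w * of_int Y \<le> - j * real n"
          using XY by (auto simp: primitive_cone_def j_def)
        have "(- \<tau> - s) * of_int Y * real n \<le> - j * (real n - 1) * real n"
          using ge npos by (simp add: w_def field_simps)
        then have "(- \<tau> - s) * of_int Y \<le> - j * (real n - 1)"
          by (rule mult_right_le_imp_le) (use npos in simp)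
        then have "j * (real n - 1) \<le> (\<tau> + s) * of_int Y" by (simp add: algebra_simps)
        then show "(X, Y) \<in> primitive_between n x x'"
          using * lt by (simp add: primitive_between_def ge_x le_x' j_def del: of_int_diff of_int_mult)
      qed
      show "totient_weight (- \<tau>) - totient_weight w \<ge> of_int q / 4"
      proof (cases "w \<ge> 1")
        case True
        then show ?thesis using add_q[OF True] totient_weight_mono[OF w_le] by linarith
      next
        \<comment> \<open>For \<open>w < 1\<close> its weight is zero, and
          \<open>- \<tau> \<ge> s \<ge> q + 1 \<ge> 2\<close> alone yields
          \<open>q / 4\<close>.\<close>
        case False
        have "- \<tau> \<ge> of_int q + 1" using 3 s_ge[OF p] by linarith
        moreover from this have "totient_weight (- \<tau>) \<ge> - \<tau> / 4"
          using q1 by (intro totient_weight_ge) linarith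
        ultimately show ?thesis using totient_weight_eq_0[of w] False by simp
      qed
    qed (use pq n w0 w_le q1 \<tau>_le in auto)
  qed
qed

text \<open>Distinct primitive points are distinct fractions of the Farey set; only \<open>x\<close>
  and \<open>y\<close> themselves fail to lie strictly between, hence the 2.\<close>

lemma card_primitive_between_le:
  assumes "0 \<le> x" "y \<le> 1"
  shows "card (primitive_between n (of_rat x) (of_rat y)) \<le> card {z \<in> farey n. x < z \<and> z < y} + 2"
proof -
  let ?f = "\<lambda>(X, Y). Fract X Y"
  have qf: "quotient_of (Fract X Y) = (X, Y)" if "(X, Y) \<in> primitive_between n (of_rat x) (of_rat y)" for X Y
    using that by (simp add: primitive_between_def quotient_of_Fract)
  have "inj_on ?f (primitive_between n (of_rat x) (of_rat y))"
    by (intro inj_onI) (metis (no_types, lifting) case_prod_beta prod.collapse qf)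
  moreover have "?f ` primitive_between n (of_rat x) (of_rat y) \<subseteq> {z \<in> farey n. x < z \<and> z < y} \<union> {x, y}"
  proof clarify
    fix X Y assume XY: "(X, Y) \<in> primitive_between n (of_rat x) (of_rat y)" "Fract X Y \<noteq> x" "Fract X Y \<notin> {}" "Fract X Y \<noteq> y"
    have "of_int X / of_int Y = (of_rat (Fract X Y) :: real)"
      using XY(1) by (simp add: of_rat_rat primitive_between_def)
    then have "x \<le> Fract X Y" "Fract X Y \<le> y"
      using XY(1) by (simp_all add: primitive_between_def of_rat_less_eq)
    then show "Fract X Y \<in> farey n \<and> x < Fract X Y \<and> Fract X Y < y"
      using qf[OF XY(1)] XY assms by (auto simp: farey_def primitive_between_def)
  qed
  ultimately have "card (primitive_between n (of_rat x) (of_rat y)) \<le> card ({z \<in> farey n. x < z \<and> z < y} \<union> {x, y})"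
    using finite_farey by (intro card_inj_on_le) auto
  also have "\<dots> \<le> card {z \<in> farey n. x < z \<and> z < y} + card {x, y}" by (rule card_Un_le)
  also have "card {x, y} \<le> 2" by (simp add: card_insert_if)
  finally show ?thesis by simp
qed

subsection \<open>Farey fractions\<close>

lemma rat_eq_numer_div_denom: "x = of_int (numer x) / of_int (denom x)"
  using quotient_of_div[of x "numer x" "denom x"] by simp

lemma denom_pos: "denom x > 0"
  by (rule quotient_of_denom_pos')

lemma rat_less_iff_cross: "x < y \<longleftrightarrow> numer x * denom y < numer y * denom x"
proof -
  have "x < y \<longleftrightarrow> (of_int (numer x) / of_int (denom x) :: rat) < of_int (numer y) / of_int (denom y)"
    using rat_eq_numer_div_denom[of x] rat_eq_numer_div_denom[of y] by simp
  also have "\<dots> \<longleftrightarrow> (of_int (numer x * denom y) :: rat) < of_int (numer y * denom x)"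
    using denom_pos[of x] denom_pos[of y] by (simp add: divide_less_eq less_divide_eq mult_ac)
  finally show ?thesis by (simp only: of_int_less_iff)
qed

lemma numer_nonneg: "0 \<le> x \<Longrightarrow> 0 \<le> numer x"
  using rat_less_iff_cross[of x 0] by (simp add: not_less[symmetric])

text \<open>The product is also negative if \<open>y\<close> has the smaller numerator and the
  larger denominator, but with nonnegative numerators that contradicts \<open>x < y\<close>.\<close>

lemma similarly_ordered_iff_not_badly_ordered:
  assumes "0 \<le> x" "x < y"
  shows "similarly_ordered x y \<longleftrightarrow> \<not> badly_ordered x y"
proof -
  have "\<not> (numer y < numer x \<and> denom x < denom y)"
  proof
    assume that: "numer y < numer x \<and> denom x < denom y"
    have "numer y * denom x \<le> numer x * denom y"
      using that numer_nonneg[of x] numer_nonneg[of y] assms denom_pos[of x] by (intro mult_mono) auto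
    then show False using assms(2) by (simp add: rat_less_iff_cross)
  qed
  then show ?thesis using assms(2)
    unfolding similarly_ordered_def badly_ordered_def zero_le_mult_iff by arith
qed

text \<open>Translates positions into counts. For \<open>j \<le> i\<close> both sides of the second
  claim are 0, by truncated subtraction.\<close>

lemma between_farey_nth:
  assumes "i < length (farey_seq n)" "j < length (farey_seq n)"
  shows "farey_seq n ! i < farey_seq n ! j \<longleftrightarrow> i < j"
    and "card {z \<in> farey n. farey_seq n ! i < z \<and> z < farey_seq n ! j} = j - i - 1"
proof -
  have sorted: "sorted_wrt (<) (farey_seq n)" by (simp add: farey_seq_def)
  have less: "farey_seq n ! i < farey_seq n ! j \<longleftrightarrow> i < j"
    if "i < length (farey_seq n)" "j < length (farey_seq n)" for i j
    using sorted_wrt_nth_less[OF sorted, of i j] sorted_wrt_nth_less[OF sorted, of j i] that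
    by (cases i j rule: linorder_cases) auto
  then show "farey_seq n ! i < farey_seq n ! j \<longleftrightarrow> i < j" using assms by blast
  have set: "set (farey_seq n) = farey n" by (simp add: farey_seq_def finite_farey)
  have "{z \<in> farey n. farey_seq n ! i < z \<and> z < farey_seq n ! j} = (\<lambda>k. farey_seq n ! k) ` {i<..<j}"
  proof (intro equalityI subsetI)
    fix z assume z: "z \<in> {z \<in> farey n. farey_seq n ! i < z \<and> z < farey_seq n ! j}"
    then have "z \<in> set (farey_seq n)" using set by simp
    then obtain k where "k < length (farey_seq n)" "z = farey_seq n ! k"
      by (metis in_set_conv_nth)
    then show "z \<in> (\<lambda>k. farey_seq n ! k) ` {i<..<j}" using z less assms by auto
  next
    fix z assume "z \<in> (\<lambda>k. farey_seq n ! k) ` {i<..<j}"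
    then obtain k where k: "z = farey_seq n ! k" "i < k" "k < j" by auto
    then have "k < length (farey_seq n)" using assms by simp
    then show "z \<in> {z \<in> farey n. farey_seq n ! i < z \<and> z < farey_seq n ! j}"
      using k less assms set nth_mem by auto
  qed
  moreover have "inj_on (\<lambda>k. farey_seq n ! k) {i<..<j}"
    using assms by (intro inj_on_nth) (auto simp: farey_seq_def)
  ultimately show "card {z \<in> farey n. farey_seq n ! i < z \<and> z < farey_seq n ! j} = j - i - 1"
    by (simp add: card_image)
qed

text \<open>A badly ordered pair at positions \<open>i < j\<close> has \<open>j - i - 1\<close>
  fractions in between, so the closest such pair is \<open>min_between n + 1\<close> positions apart
  and \<open>min_between n\<close> is the last safe distance.\<close>

lemma similar_range_eq_min_between:
  assumes "n \<ge> 4"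
  shows "similar_range n = int (min_between n)"
proof (rule antisym)
  have set: "set (farey_seq n) = farey n" by (simp add: farey_seq_def finite_farey)
  show "similar_range n \<le> int (min_between n)"
  proof (rule ccontr)
    assume "\<not> similar_range n \<le> int (min_between n)"
    obtain x y where xy: "x \<in> farey n" "y \<in> farey n" "badly_ordered x y"
        "min_between n = card {z \<in> farey n. x < z \<and> z < y}"
      using min_between_attained(1)[OF assms] by blast
    then obtain i j where ij: "i < length (farey_seq n)" "j < length (farey_seq n)"
        "x = farey_seq n ! i" "y = farey_seq n ! j"
      using set by (metis in_set_conv_nth)
    have "x < y" using xy by (simp add: badly_ordered_def)
    then have "i < j" using between_farey_nth(1)[OF ij(1,2)] ij by simp
    moreover have "min_between n = j - i - 1" using xy(4) between_farey_nth(2)[OF ij(1,2)] ij by simp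
    ultimately have "\<bar>int i - int j\<bar> \<le> similar_range n"
      using \<open>\<not> similar_range n \<le> int (min_between n)\<close> by linarith
    then have "similarly_ordered x y"
      using similar_range_greatest(1)[OF assms] ij unfolding similar_within_def by blast
    then show False using similarly_ordered_iff_not_badly_ordered[of x y] xy \<open>x < y\<close>
      by (simp add: farey_def)
  qed
  have "similarly_ordered (farey_seq n ! i) (farey_seq n ! j)"
    if ij: "i < j" "j < length (farey_seq n)" "j - i \<le> min_between n" for i j
  proof -
    let ?x = "farey_seq n ! i" and ?y = "farey_seq n ! j"
    have i: "i < length (farey_seq n)" using ij by simp
    have xy: "?x \<in> farey n" "?y \<in> farey n" using nth_mem[OF i] nth_mem[OF ij(2)] set by auto
    have "?x < ?y" using between_farey_nth(1)[OF i ij(2)] ij by simp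
    moreover have "\<not> badly_ordered ?x ?y"
      using min_between_attained(2)[OF assms xy] between_farey_nth(2)[OF i ij(2)] ij by auto
    ultimately show ?thesis
      using similarly_ordered_iff_not_badly_ordered[of ?x ?y] xy by (simp add: farey_def)
  qed note sim = this
  have "similar_within n (int (min_between n))"
    unfolding similar_within_def
  proof (intro allI impI)
    fix i j assume ij: "i < length (farey_seq n)" "j < length (farey_seq n)"
      "\<bar>int i - int j\<bar> \<le> int (min_between n)"
    have comm: "similarly_ordered x y \<longleftrightarrow> similarly_ordered y x" for x y
      by (simp add: similarly_ordered_def zero_le_mult_iff) auto
    show "similarly_ordered (farey_seq n ! i) (farey_seq n ! j)"
    proof (cases i j rule: linorder_cases)
      case less
      then show ?thesis using ij by (intro sim) auto
    next
      case equal
      then show ?thesis by (simp add: similarly_ordered_def)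
    next
      case greater
      then show ?thesis using ij by (subst comm, intro sim) auto
    qed
  qed
  then show "int (min_between n) \<le> similar_range n" by (rule similar_range_greatest(2)[OF assms])
qed

section \<open>Lower bound for every badly ordered pair\<close>

lemma card_between_badly_ordered_ge:
  assumes n: "n \<ge> 16" and xy: "x \<in> farey n" "y \<in> farey n" "badly_ordered x y"
  shows "real (card {z \<in> farey n. x < z \<and> z < y}) \<ge> real n / 4 - 4 * (4 * sqrt n) * sqrt (4 * sqrt n) - 2"
proof -
  define a b c d where "a = numer x" and "b = denom x" and "c = numer y" and "d = denom y"
  note abcd = a_def b_def c_def d_def
  have bad: "a < c" "d < b" using xy by (auto simp: badly_ordered_def abcd)
  have pos: "b > 0" "d > 0" unfolding abcd by (rule denom_pos)+
  have x: "0 \<le> x" "b \<le> int n" and y: "y \<le> 1" using xy by (auto simp: farey_def abcd)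
  have rx: "real_of_rat x = of_int a / of_int b" and ry: "real_of_rat y = of_int c / of_int d"
    using rat_eq_numer_div_denom[of x] rat_eq_numer_div_denom[of y] unfolding abcd
    by (metis of_rat_divide of_rat_of_int_eq)+
  \<comment> \<open>A zero numerator means 0/1, and no denominator is smaller than 1. With
    \<open>a \<ge> 1\<close> and \<open>b \<le> n\<close> follows
    \<open>\<xi> \<ge> 1 / n\<close>.\<close>
  have "a \<noteq> 0"
  proof
    assume "a = 0"
    then have "x = 0" using rat_eq_numer_div_denom[of x] by (simp add: abcd)
    then have "b = 1" by (simp add: abcd)
    then show False using bad pos by simp
  qed
  then have a: "a \<ge> 1" using numer_nonneg[OF x(1)] by (simp add: abcd)
  define \<xi> where "\<xi> = real_of_rat x"
  define \<xi>' where "\<xi>' = \<xi> + (1 + \<xi>) / (real n - 1)"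
  have r: "real_of_int a \<ge> 1" "real_of_int b \<ge> 2" "real_of_int d \<ge> 1" "real_of_int d \<le> of_int b - 1"
    "real_of_int c \<ge> of_int a + 1" "real_of_int b \<le> real n"
    using a bad pos x(2) by linarith+
  have "1 / real n \<le> \<xi>"
    unfolding \<xi>_def rx by (rule frac_le) (use r in auto)
  \<comment> \<open>The gap from \<open>a / b\<close> to \<open>(a + 1) / (b - 1)\<close> is exactly
    \<open>(1 + \<xi>) / (b - 1)\<close>; for fixed \<open>\<xi>\<close> it only shrinks when
    \<open>b\<close> is replaced by \<open>n\<close>.\<close>
  have "\<xi>' \<le> \<xi> + (1 + \<xi>) / (of_int b - 1)"
    unfolding \<xi>'_def \<xi>_def rx using r by (intro add_left_mono divide_left_mono) auto
  also have "\<dots> = (of_int a + 1) / (of_int b - 1)"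
    unfolding \<xi>_def rx using r by (simp add: field_simps)
  also have "\<dots> \<le> of_int c / of_int d"
    using r by (intro frac_le) auto
  finally have le: "\<xi>' \<le> real_of_rat y" unfolding ry .
  also have "\<dots> \<le> 1" using y by simp
  finally have "\<xi>' \<le> 1" .
  with card_primitive_between_ge[OF n, of \<xi>] \<open>1 / real n \<le> \<xi>\<close>
  have "real n / 4 - 4 * (4 * sqrt n) * sqrt (4 * sqrt n) \<le> real (card (primitive_between n \<xi> \<xi>'))"
    unfolding \<xi>'_def by simp
  also have "card (primitive_between n \<xi> \<xi>') \<le> card (primitive_between n \<xi> (real_of_rat y))"
    by (rule card_mono[OF finite_primitive_between]) (use le in \<open>auto simp: primitive_between_def\<close>)
  also have "\<dots> \<le> card {z \<in> farey n. x < z \<and> z < y} + 2"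
    unfolding \<xi>_def by (rule card_primitive_between_le[OF x(1) y])
  finally show ?thesis by simp
qed

section \<open>Upper bound from an explicit pair near 1/2\<close>

text \<open>The \<open>k\<close> below is the largest with \<open>4 k + 1 \<le> n\<close>. Sorted by
  \<open>j = 2 X - Y\<close>, the fractions in between lie on four lines; \<open>j = 1\<close>
  carries at most \<open>k + 2\<close> of them, the others together at most 4.\<close>

lemma min_between_le:
  assumes n: "n \<ge> 9"
  shows "min_between n \<le> (n - 1) div 4 + 6"
proof -
  define k where "k = int ((n - 1) div 4)"
  have k: "k \<ge> 2" "4 * k + 1 \<le> int n" "int n \<le> 4 * k + 4" using n unfolding k_def by linarith+
  define x y where "x = Fract (2 * k) (4 * k + 1)" and "y = Fract (2 * k + 1) (4 * k)"
  have "coprime (2 * k) (4 * k + 1)"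
  proof (rule coprimeI)
    fix e assume e: "e dvd 2 * k" "e dvd 4 * k + 1"
    have "e dvd (4 * k + 1) - 2 * (2 * k)" by (rule dvd_diff[OF e(2) dvd_mult[OF e(1)]])
    then show "is_unit e" by simp
  qed
  then have qx: "quotient_of x = (2 * k, 4 * k + 1)" using k by (simp add: x_def quotient_of_Fract)
  have "coprime (2 * k + 1) (4 * k)"
  proof (rule coprimeI)
    fix e assume e: "e dvd 2 * k + 1" "e dvd 4 * k"
    have "e dvd 2 * (2 * k + 1) - 4 * k" by (rule dvd_diff[OF dvd_mult[OF e(1)] e(2)])
    then have "e dvd 2" by simp
    then have "e dvd k * 2" by (rule dvd_mult)
    then have "e dvd (2 * k + 1) - k * 2" using e by (intro dvd_diff)
    then show "is_unit e" by simp
  qed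
  then have qy: "quotient_of y = (2 * k + 1, 4 * k)" using k by (simp add: y_def quotient_of_Fract)
  have bad: "badly_ordered x y"
    using k unfolding badly_ordered_def rat_less_iff_cross by (simp add: qx qy algebra_simps)
  have "x \<in> farey n" "y \<in> farey n"
    using k qx qy unfolding farey_def
    by (auto simp: x_def y_def zero_le_Fract_iff Fract_le_one_iff)
  then have "min_between n \<le> card {z \<in> farey n. x < z \<and> z < y}"
    using n bad by (intro min_between_attained(2)) auto
  also have "\<dots> \<le> card ({(1, 2), (2 * k + 1, 4 * k + 3), (2 * k + 2, 4 * k + 2), (2 * k + 3, 4 * k + 4)} \<union>
      (\<lambda>X. (X, 2 * X - 1)) ` {k + 1..2 * k + 2})"
  proof (rule card_inj_on_le)
    show "inj_on quotient_of {z \<in> farey n. x < z \<and> z < y}"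
      by (auto simp: inj_on_def quotient_of_inject_eq)
    show "quotient_of ` {z \<in> farey n. x < z \<and> z < y} \<subseteq>
        {(1, 2), (2 * k + 1, 4 * k + 3), (2 * k + 2, 4 * k + 2), (2 * k + 3, 4 * k + 4)} \<union>
        (\<lambda>X. (X, 2 * X - 1)) ` {k + 1..2 * k + 2}"
    proof (rule image_subsetI)
      fix z assume "z \<in> {z \<in> farey n. x < z \<and> z < y}"
      then have z: "z \<in> farey n" "x < z" "z < y" by auto
      obtain X Y where XY: "quotient_of z = (X, Y)" by force
      define j where "j = 2 * X - Y"
      have Y: "Y = 2 * X - j" by (simp add: j_def)
      have "0 < Y" "Y \<le> int n" using quotient_of_denom_pos[OF XY] z by (auto simp: farey_def XY)
      \<comment> \<open>In terms of \<open>j\<close>, lying between \<open>x\<close> and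
        \<open>y\<close> means \<open>- X < 2 k j < Y\<close>, which with
        \<open>Y \<le> 4 k + 4\<close> leaves few values of \<open>j\<close>.\<close>
      have "2 * k * Y < X * (4 * k + 1)" "X * (4 * k) < (2 * k + 1) * Y"
        using z(2,3) unfolding rat_less_iff_cross qx qy XY by auto
      then have lo: "- X < 2 * (k * j)" and hi: "2 * (k * j) < Y"
        unfolding Y by (simp_all add: algebra_simps)
      have "X > 0"
      proof (rule ccontr)
        assume "\<not> X > 0"
        then have "k * j \<le> 0" using Y \<open>0 < Y\<close> k by (intro mult_nonneg_nonpos) auto
        then show False using lo \<open>\<not> X > 0\<close> by linarith
      qed
      \<comment> \<open>\<open>j \<ge> 3\<close> would need \<open>6 k < Y \<le> 4 k + 4\<close>,
        impossible for \<open>k \<ge> 2\<close>, that is, for \<open>n \<ge> 9\<close>.\<close>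
      have "j \<le> 2"
      proof (rule ccontr)
        assume "\<not> j \<le> 2"
        then have "k * 3 \<le> k * j" using k by (intro mult_left_mono) auto
        then show False using hi \<open>Y \<le> int n\<close> k by linarith
      qed
      moreover have "j \<ge> - 1"
      proof (rule ccontr)
        assume "\<not> j \<ge> - 1"
        then have "k * j \<le> k * (- 2)" using k by (intro mult_left_mono) auto
        then show False using lo \<open>Y \<le> int n\<close> k \<open>\<not> j \<ge> - 1\<close> Y by linarith
      qed
      ultimately consider "j = - 1" | "j = 0" | "j = 1" | "j = 2" by linarith
      then have "(X, Y) \<in> {(1, 2), (2 * k + 1, 4 * k + 3), (2 * k + 2, 4 * k + 2), (2 * k + 3, 4 * k + 4)} \<union>
        (\<lambda>X. (X, 2 * X - 1)) ` {k + 1..2 * k + 2}"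
      proof cases
        case 1
        then have "X = 2 * k + 1" using lo Y \<open>Y \<le> int n\<close> k by simp
        then show ?thesis using Y 1 by simp
      next
        case 2
        then have "X dvd Y" using Y by simp
        then have "is_unit X" using quotient_of_coprime[OF XY] by (meson coprime_common_divisor dvd_refl)
        then have "X = 1" using \<open>X > 0\<close> by simp
        then show ?thesis using Y 2 by simp
      next
        case 3
        then have "2 * k < Y" "Y = 2 * X - 1" using hi Y by simp_all
        then have "k + 1 \<le> X" "X \<le> 2 * k + 2" using \<open>Y \<le> int n\<close> k by linarith+
        then show ?thesis using Y 3 by auto
      next
        case 4
        then have "X = 2 * k + 2 \<or> X = 2 * k + 3" using hi Y \<open>Y \<le> int n\<close> k by auto
        then show ?thesis using Y 4 by auto
      qed
      then show "quotient_of z \<in> {(1, 2), (2 * k + 1, 4 * k + 3), (2 * k + 2, 4 * k + 2), (2 * k + 3, 4 * k + 4)} \<union>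
        (\<lambda>X. (X, 2 * X - 1)) ` {k + 1..2 * k + 2}"
        by (simp only: XY)
    qed
  qed auto
  also have "\<dots> \<le> 4 + card ((\<lambda>X. (X, 2 * X - 1)) ` {k + 1..2 * k + 2})"
    by (rule order_trans[OF card_Un_le]) (simp add: card_insert_if)
  also have "\<dots> \<le> 4 + card {k + 1..2 * k + 2}"
    by (intro add_left_mono card_image_le) simp
  also have "\<dots> = (n - 1) div 4 + 6" using k by (simp add: k_def nat_add_distrib)
  finally show ?thesis .
qed

section \<open>Asymptotics\<close>

text \<open>The deviation from \<open>n / 4\<close> is at most \<open>32 n powr (3/4) + 2\<close>
  downwards and 6 upwards, for large \<open>n\<close>.\<close>

lemma min_between_asymp: "(\<lambda>n. real (min_between n) / real n) \<longlonglongrightarrow> 1/4"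
proof (rule tendsto_sandwich)
  show "\<forall>\<^sub>F n in sequentially.
      (real n / 4 - 4 * (4 * sqrt n) * sqrt (4 * sqrt n) - 2) / real n \<le> real (min_between n) / real n"
  proof (rule eventually_mono[OF eventually_ge_at_top[of 16]])
    fix n :: nat assume n: "16 \<le> n"
    then obtain x y where "x \<in> farey n" "y \<in> farey n" "badly_ordered x y"
        "min_between n = card {z \<in> farey n. x < z \<and> z < y}"
      using min_between_attained(1)[of n] by auto
    then show "(real n / 4 - 4 * (4 * sqrt n) * sqrt (4 * sqrt n) - 2) / real n \<le> real (min_between n) / real n"
      using card_between_badly_ordered_ge[OF n] by (intro divide_right_mono) auto
  qed
  show "\<forall>\<^sub>F n in sequentially. real (min_between n) / real n \<le> (real n / 4 + 6) / real n"
  proof (rule eventually_mono[OF eventually_ge_at_top[of 9]])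
    fix n :: nat assume "9 \<le> n"
    then have "real (min_between n) \<le> real n / 4 + 6"
      using min_between_le[of n] by linarith
    then show "real (min_between n) / real n \<le> (real n / 4 + 6) / real n"
      by (intro divide_right_mono) auto
  qed
  show "(\<lambda>n. (real n / 4 - 4 * (4 * sqrt n) * sqrt (4 * sqrt n) - 2) / real n) \<longlonglongrightarrow> 1/4"
    by real_asymp
  show "(\<lambda>n. (real n / 4 + 6) / real n) \<longlonglongrightarrow> 1/4"
    by real_asymp
qed

theorem theorem1:
  shows "(\<exists>\<epsilon> :: nat \<Rightarrow> real. \<epsilon> \<in> o[at_top](\<lambda>_. 1) \<and>
            (\<forall>n\<ge>4. real (min_between n) = (1/4 + \<epsilon> n) * real n)) \<and>
         (\<exists>\<epsilon> :: nat \<Rightarrow> real. \<epsilon> \<in> o[at_top](\<lambda>_. 1) \<and>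
            (\<forall>n\<ge>4. real_of_int (similar_range n) = (1/4 + \<epsilon> n) * real n))"
proof -
  \<comment> \<open>One error function serves both claims, because the two quantities coincide for
    \<open>n \<ge> 4\<close>.\<close>
  define \<epsilon> where "\<epsilon> = (\<lambda>n. real (min_between n) / real n - 1/4)"
  have "\<epsilon> \<longlonglongrightarrow> 0"
    using tendsto_diff[OF min_between_asymp tendsto_const[of "1/4"]] by (simp add: \<epsilon>_def)
  then have "\<epsilon> \<in> o[at_top](\<lambda>_. 1)" by (intro smalloI_tendsto) auto
  moreover have "\<forall>n\<ge>4. real (min_between n) = (1/4 + \<epsilon> n) * real n" by (simp add: \<epsilon>_def)
  moreover from this have "\<forall>n\<ge>4. real_of_int (similar_range n) = (1/4 + \<epsilon> n) * real n"
    by (simp add: similar_range_eq_min_between)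
  ultimately show ?thesis by blast
qed

end
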